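(* Assume $N=1$, so $I=\{1\}$ and $\mathbb{Z}\Pi=\mathbb{Z}\alpha_1$. Let $\chi:\mathbb{Z}\Pi\times\mathbb{Z}\Pi\to\mathbb{K}^\times$ be a bi-homomorphism such that $\dim U^-(\chi)=\infty$, and let $\Lambda\in\mathrm{Ch}(U^0(\chi))$. Then $\dim\mathcal{L}_\chi(\Lambda)<\infty$ if and only if there exists an integer $r\ge 0$ with $\Lambda(K_{\alpha_1}L_{-\alpha_1})=\chi(\alpha_1,\alpha_1)^r$.
   Context: $\mathbb{K}$ is a field of characteristic $0$, $\mathbb{K}^\times=\mathbb{K}\setminus\{0\}$. $N\ge1$ is an integer, $I=\{1,\dots,N\}$, $\Pi=\{\alpha_i\mid i\in I\}$, $\mathbb{Z}\Pi=\bigoplus_{i\in I}\mathbb{Z}\alpha_i$ (free $\mathbb{Z}$-module), $\mathbb{Z}_{\ge0}\Pi=\bigoplus_{i\in I}\mathbb{Z}_{\ge0}\alpha_i$. A bi-homomorphism is a map $\chi:\mathbb{Z}\Pi\times\mathbb{Z}\Pi\to\mathbb{K}^\times$ with $\chi(\alpha,\beta+\gamma)=\chi(\alpha,\beta)\chi(\alpha,\gamma)$ and $\chi(\alpha+\beta,\gamma)=\chi(\alpha,\gamma)\chi(\beta,\gamma)$. Generalized quantum group $U(\chi)$: $\tilde U=\tilde U(\chi)$ is the unital associative $\mathbb{K}$-algebra with generators $\tilde K_\alpha,\tilde L_\alpha$ ($\alpha\in\mathbb{Z}\Pi$), $\tilde E_i,\tilde F_i$ ($i\in I$) and relations $\tilde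 K_0=\tilde L_0=1$, $\tilde K_\alpha\tilde K_\beta=\tilde K_{\alpha+\beta}$, $\tilde L_\alpha\tilde L_\beta=\tilde L_{\alpha+\beta}$, $\tilde K_\alpha\tilde L_\beta=\tilde L_\beta\tilde K_\alpha$, $\tilde K_\alpha\tilde E_i=\chi(\alpha,\alpha_i)\tilde E_i\tilde K_\alpha$, $\tilde L_\alpha\tilde E_i=\chi(-\alpha_i,\alpha)\tilde E_i\tilde L_\alpha$, $\tilde K_\alpha\tilde F_i=\chi(\alpha,-\alpha_i)\tilde F_i\tilde K_\alpha$, $\tilde L_\alpha\tilde F_i=\chi(\alpha_i,\alpha)\tilde F_i\tilde L_\alpha$, $\tilde E_i\tilde F_j-\tilde F_j\tilde E_i=\delta_{ij}(-\tilde K_{\alpha_i}+\tilde L_{\alpha_i})$. It is $\mathbb{Z}\Pi$-graded with $\tilde K_\alpha,\tilde L_\alpha$ in degree $0$, $\tilde E_i$ in degree $\alpha_i$, $\tilde F_i$ in degree $-\alpha_i$. $\tilde U^0,\tilde U^+,\tilde U^-$ are the unital subalgebras generated by the $\tilde K_\alpha,\tilde L_\alpha$, by the $\tilde E_i$, and by the $\tilde F_i$. Define subspaces $\tilde{\mathcal I}^-_{-\alpha}\subseteq\tilde U^-_{-\alpha}$ ($\alpha\in\mathbb{Z}_{\ge0}\Pi$) inductively: $\tilde{\mathcal I}^-_0=0$ and, for $\alpha\ne0$, $\tilde{\mathcal I}^-_{-\alpha}$ is the set of $Y\in\tilde U^-_{-\alpha}$ with $[\tilde E_i,Y]\in\tilde{\mathcal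 I}^-_{-\alpha+\alpha_i}\tilde K_{\alpha_i}+\tilde{\mathcal I}^-_{-\alpha+\alpha_i}\tilde L_{\alpha_i}$ for all $i$ with $\alpha-\alpha_i\in\mathbb{Z}_{\ge0}\Pi$. Put $\tilde{\mathcal I}^-=\bigoplus_\alpha\tilde{\mathcal I}^-_{-\alpha}$ and $\tilde{\mathcal J}^-=\mathrm{Span}_{\mathbb{K}}(\tilde{\mathcal I}^-\tilde U^0\tilde U^+)$ (an ideal). Let $\tilde\Omega$ be the algebra automorphism of $\tilde U$ with $\tilde K_\alpha\mapsto\tilde K_{-\alpha}$, $\tilde L_\alpha\mapsto\tilde L_{-\alpha}$, $\tilde E_i\mapsto\tilde F_i\tilde L_{-\alpha_i}$, $\tilde F_i\mapsto\tilde K_{-\alpha_i}\tilde E_i$. Then $U(\chi)=\tilde U/(\tilde{\mathcal J}^-+\tilde\Omega(\tilde{\mathcal J}^-))$. Images of generators are written $K_\alpha,L_\alpha,E_i,F_i$; $U^0(\chi),U^\pm(\chi)$ are the images of $\tilde U^0,\tilde U^\pm$, and $U(\chi)_\alpha,U^\pm(\chi)_\alpha$ denote degree-$\alpha$ parts. Multiplication $U^-\otimes U^0\otimes U^+\to U$ is a linear isomorphism and the $K_\alpha L_\beta$ form a basis of $U^0$. Highest weight modules: $\mathrm{Ch}(U^0(\chi))$ is the set of unital $\mathbb{K}$-algebra homomorphisms $U^0(\chi)\to\mathbb{K}$. For $\Lambda\in\mathrm{Ch}(U^0(\chi))$, $\mathcal{M}_\chi(\Lambda)$ is the Verma module: generated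 by $\tilde v_\Lambda\neq 0$ with $Z\tilde v_\Lambda=\Lambda(Z)\tilde v_\Lambda$ ($Z\in U^0$), $E_i\tilde v_\Lambda=0$ ($i\in I$), and $U^-\to\mathcal{M}_\chi(\Lambda)$, $Y\mapsto Y\tilde v_\Lambda$ bijective; it is graded by $\mathcal{M}_\chi(\Lambda)_\alpha=U^-_\alpha\tilde v_\Lambda$. $\mathcal{L}_\chi(\Lambda)$ is the quotient of $\mathcal{M}_\chi(\Lambda)$ by its maximal proper $\mathbb{Z}\Pi$-graded submodule. *)

theory Defs
  imports
    "HOL-Library.Poly_Mapping"
    "HOL-Algebra.QuotRing"
    "Jordan_Normal_Form.VS_Connect"
begin

section \<open>Algebras and modules\<close>

text \<open>
  An associative unital \<open>K\<close>-algebra over a field type \<^typ>\<open>'k\<close>, not necessarily commutative, is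
  a \<^typ>\<open>('k, 'a) module\<close> record in which all fields are meaningful; \<^const>\<open>smult\<close> is the scalar
  multiplication.  A left module over an algebra with elements of type \<^typ>\<open>'u\<close> is
  a \<^typ>\<open>('u, 'm) module\<close> record in which the fields \<^const>\<open>mult\<close> and \<^const>\<open>one\<close> are irrelevant.
  The locale \<^locale>\<open>module\<close> is not usable for the latter, because it demands a commutative ring.
\<close>

text \<open>In both readings the next definition is the quotient: of an algebra by a two-sided ideal, or
  of a module by a submodule.\<close>

definition quot :: "('c, 'a, 'z) module_scheme \<Rightarrow> 'a set \<Rightarrow> ('c, 'a set) module" where
  "quot M N =
    \<lparr>carrier = carrier (M Quot N), mult = mult (M Quot N), one = one (M Quot N),
     zero = zero (M Quot N), add = add (M Quot N),
     smult = (\<lambda>c X. \<Union>x\<in>X. N +>\<^bsub>M\<^esub> (c \<odot>\<^bsub>M\<^esub> x))\<rparr>"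

abbreviation kspan :: "('k::field, 'a, 'z) module_scheme \<Rightarrow> 'a set \<Rightarrow> 'a set" where
  "kspan V S \<equiv> LinearCombinations.module.span class_ring V S"

abbreviation finite_dim :: "('k::field, 'a, 'z) module_scheme \<Rightarrow> bool" where
  "finite_dim V \<equiv> vectorspace.fin_dim class_ring V"

inductive_set subalg_gen :: "('k, 'a, 'z) module_scheme \<Rightarrow> 'a set \<Rightarrow> 'a set"
  for A (structure) and S where
  one: "\<one> \<in> subalg_gen A S"
| incl: "s \<in> S \<Longrightarrow> s \<in> subalg_gen A S"
| add: "x \<in> subalg_gen A S \<Longrightarrow> y \<in> subalg_gen A S \<Longrightarrow> x \<oplus> y \<in> subalg_gen A S"
| mult: "x \<in> subalg_gen A S \<Longrightarrow> y \<in> subalg_gen A S \<Longrightarrow> x \<otimes> y \<in> subalg_gen A S"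
| smult: "x \<in> subalg_gen A S \<Longrightarrow> c \<odot> x \<in> subalg_gen A S"

definition scalar_alg :: "('k::field, 'k) module" where
  "scalar_alg = \<lparr>carrier = UNIV, mult = (*), one = 1, zero = 0, add = (+), smult = (*)\<rparr>"

definition alg_hom ::
    "('k, 'a, 'y) module_scheme \<Rightarrow> ('k, 'b, 'z) module_scheme \<Rightarrow> ('a \<Rightarrow> 'b) set" where
  "alg_hom A B =
    {h \<in> Ring.ring_hom A B. \<forall>c. \<forall>x\<in>carrier A. h (c \<odot>\<^bsub>A\<^esub> x) = c \<odot>\<^bsub>B\<^esub> h x}"

definition commutator :: "('a, 'z) ring_scheme \<Rightarrow> 'a \<Rightarrow> 'a \<Rightarrow> 'a" where
  "commutator A x y = (x \<otimes>\<^bsub>A\<^esub> y) \<ominus>\<^bsub>A\<^esub> (y \<otimes>\<^bsub>A\<^esub> x)"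

definition regular_module :: "('k, 'a) module \<Rightarrow> ('a, 'a) module" where
  "regular_module A =
    \<lparr>carrier = carrier A, mult = mult A, one = one A, zero = zero A, add = add A, smult = mult A\<rparr>"

definition restrict_scalars :: "('k, 'u) module \<Rightarrow> ('u, 'm) module \<Rightarrow> ('k, 'm) module" where
  "restrict_scalars A M =
    \<lparr>carrier = carrier M, mult = mult M, one = one M, zero = zero M, add = add M,
     smult = (\<lambda>c m. (c \<odot>\<^bsub>A\<^esub> \<one>\<^bsub>A\<^esub>) \<odot>\<^bsub>M\<^esub> m)\<rparr>"

definition left_submodule :: "('k, 'u) module \<Rightarrow> ('u, 'm) module \<Rightarrow> 'm set \<Rightarrow> bool" where
  "left_submodule A M N \<longleftrightarrow>
     N \<subseteq> carrier M \<and> \<zero>\<^bsub>M\<^esub> \<in> N \<and> (\<forall>x\<in>N. \<forall>y\<in>N. x \<oplus>\<^bsub>M\<^esub> y \<in> N) \<and>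
     (\<forall>u\<in>carrier A. \<forall>x\<in>N. u \<odot>\<^bsub>M\<^esub> x \<in> N)"

definition left_submodule_gen :: "('k, 'u) module \<Rightarrow> ('u, 'm) module \<Rightarrow> 'm set \<Rightarrow> 'm set" where
  "left_submodule_gen A M S = \<Inter>{N. left_submodule A M N \<and> S \<subseteq> N}"


section \<open>Free algebras\<close>

text \<open>The free monoid, written additively so that finitely supported functions on it carry the
  convolution product of \<^theory>\<open>HOL-Library.Poly_Mapping\<close>; this is the free algebra.\<close>

datatype 'g free_word = Word (letters: "'g list")

instantiation free_word :: (type) monoid_add
begin

definition "0 = Word []"

definition "u + v = Word (letters u @ letters v)"

instance
  by standard (simp_all add: zero_free_word_def plus_free_word_def)

end

type_synonym ('g, 'k) free_alg = "'g free_word \<Rightarrow>\<^sub>0 'k"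

abbreviation scal :: "'k::field \<Rightarrow> ('g, 'k) free_alg" where
  "scal c \<equiv> Poly_Mapping.single 0 c"

definition free_gen :: "'g \<Rightarrow> ('g, 'k::field) free_alg" where
  "free_gen g = Poly_Mapping.single (Word [g]) 1"

definition free_algebra :: "('k::field, ('g, 'k) free_alg) module" where
  "free_algebra =
    \<lparr>carrier = UNIV, mult = (*), one = 1, zero = 0, add = (+), smult = (\<lambda>c f. scal c * f)\<rparr>"


section \<open>Root lattice and bi-homomorphisms\<close>

text \<open>The index set \<open>I\<close> is a type \<^typ>\<open>'i\<close>, and \<open>\<int>\<Pi>\<close> is the free abelian group on it.\<close>

type_synonym 'i root_lattice = "'i \<Rightarrow>\<^sub>0 int"

definition simple_root :: "'i \<Rightarrow> 'i root_lattice" (\<open>\<alpha>\<close>) where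
  "\<alpha> i = Poly_Mapping.single i 1"

definition nonneg :: "'i root_lattice set" where
  "nonneg = {a. \<forall>i. 0 \<le> Poly_Mapping.lookup a i}"

definition bihom :: "('i root_lattice \<Rightarrow> 'i root_lattice \<Rightarrow> 'k::field) \<Rightarrow> bool" where
  "bihom \<chi> \<longleftrightarrow>
     (\<forall>a b. \<chi> a b \<noteq> 0) \<and>
     (\<forall>a b c. \<chi> a (b + c) = \<chi> a b * \<chi> a c) \<and>
     (\<forall>a b c. \<chi> (a + b) c = \<chi> a c * \<chi> b c)"

type_synonym ('i, 'k) bichar = "'i root_lattice \<Rightarrow> 'i root_lattice \<Rightarrow> 'k"


section \<open>The algebra before taking the quotient by the radicals\<close>

datatype 'i qgen = GK "'i root_lattice" | GL "'i root_lattice" | GE 'i | GF 'i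

type_synonym ('i, 'k) pre = "('i qgen, 'k) free_alg"

abbreviation fK :: "'i root_lattice \<Rightarrow> ('i, 'k::field) pre" where "fK a \<equiv> free_gen (GK a)"
abbreviation fL :: "'i root_lattice \<Rightarrow> ('i, 'k::field) pre" where "fL a \<equiv> free_gen (GL a)"
abbreviation fE :: "'i \<Rightarrow> ('i, 'k::field) pre" where "fE i \<equiv> free_gen (GE i)"
abbreviation fF :: "'i \<Rightarrow> ('i, 'k::field) pre" where "fF i \<equiv> free_gen (GF i)"

text \<open>A defining relation \<open>l = r\<close> is recorded as the element \<open>l - r\<close> of the free algebra.\<close>

inductive_set relators :: "('i, 'k::field) bichar \<Rightarrow> ('i, 'k) pre set" for \<chi> where
  "fK 0 - 1 \<in> relators \<chi>"
| "fL 0 - 1 \<in> relators \<chi>"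
| "fK a * fK b - fK (a + b) \<in> relators \<chi>"
| "fL a * fL b - fL (a + b) \<in> relators \<chi>"
| "fK a * fL b - fL b * fK a \<in> relators \<chi>"
| "fK a * fE i - scal (\<chi> a (\<alpha> i)) * (fE i * fK a) \<in> relators \<chi>"
| "fL a * fE i - scal (\<chi> (- \<alpha> i) a) * (fE i * fL a) \<in> relators \<chi>"
| "fK a * fF i - scal (\<chi> a (- \<alpha> i)) * (fF i * fK a) \<in> relators \<chi>"
| "fL a * fF i - scal (\<chi> (\<alpha> i) a) * (fF i * fL a) \<in> relators \<chi>"
| "fE i * fF j - fF j * fE i - (if i = j then - fK (\<alpha> i) + fL (\<alpha> i) else 0) \<in> relators \<chi>"

definition rel_ideal :: "('i, 'k::field) bichar \<Rightarrow> ('i, 'k) pre set" where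
  "rel_ideal \<chi> = Idl\<^bsub>free_algebra\<^esub> (relators \<chi>)"

definition Ut :: "('i, 'k::field) bichar \<Rightarrow> ('k, ('i, 'k) pre set) module" where
  "Ut \<chi> = quot free_algebra (rel_ideal \<chi>)"

definition to_Ut :: "('i, 'k::field) bichar \<Rightarrow> ('i, 'k) pre \<Rightarrow> ('i, 'k) pre set" where
  "to_Ut \<chi> f = rel_ideal \<chi> +>\<^bsub>free_algebra\<^esub> f"

abbreviation tK :: "('i, 'k::field) bichar \<Rightarrow> 'i root_lattice \<Rightarrow> ('i, 'k) pre set" where
  "tK \<chi> a \<equiv> to_Ut \<chi> (fK a)"
abbreviation tL :: "('i, 'k::field) bichar \<Rightarrow> 'i root_lattice \<Rightarrow> ('i, 'k) pre set" where
  "tL \<chi> a \<equiv> to_Ut \<chi> (fL a)"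
abbreviation tE :: "('i, 'k::field) bichar \<Rightarrow> 'i \<Rightarrow> ('i, 'k) pre set" where
  "tE \<chi> i \<equiv> to_Ut \<chi> (fE i)"
abbreviation tF :: "('i, 'k::field) bichar \<Rightarrow> 'i \<Rightarrow> ('i, 'k) pre set" where
  "tF \<chi> i \<equiv> to_Ut \<chi> (fF i)"

definition Ut_zero :: "('i, 'k::field) bichar \<Rightarrow> ('i, 'k) pre set set" where
  "Ut_zero \<chi> = subalg_gen (Ut \<chi>) (range (tK \<chi>) \<union> range (tL \<chi>))"

definition Ut_plus :: "('i, 'k::field) bichar \<Rightarrow> ('i, 'k) pre set set" where
  "Ut_plus \<chi> = subalg_gen (Ut \<chi>) (range (tE \<chi>))"

definition Ut_minus :: "('i, 'k::field) bichar \<Rightarrow> ('i, 'k) pre set set" where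
  "Ut_minus \<chi> = subalg_gen (Ut \<chi>) (range (tF \<chi>))"

fun gen_degree :: "'i qgen \<Rightarrow> 'i root_lattice" where
  "gen_degree (GK a) = 0"
| "gen_degree (GL a) = 0"
| "gen_degree (GE i) = \<alpha> i"
| "gen_degree (GF i) = - \<alpha> i"

definition word_degree :: "'i qgen free_word \<Rightarrow> 'i root_lattice" where
  "word_degree w = sum_list (map gen_degree (letters w))"

definition Ut_degree :: "('i, 'k::field) bichar \<Rightarrow> 'i root_lattice \<Rightarrow> ('i, 'k) pre set set" where
  "Ut_degree \<chi> a = to_Ut \<chi> ` {f. \<forall>w\<in>Poly_Mapping.keys f. word_degree w = a}"

text \<open>\<open>neg_rad \<chi> a Y\<close> says that \<open>Y\<close> lies in the component of degree \<open>- a\<close> of the ideal \<open>I\<close> of the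
  negative part.  The recursion is well-founded in \<open>a\<close>, so the inductive definition below agrees
  with the recursive one (the implication in its second rule is an equivalence for \<open>a \<noteq> 0\<close>).\<close>

inductive neg_rad ::
    "('i, 'k::field) bichar \<Rightarrow> 'i root_lattice \<Rightarrow> ('i, 'k) pre set \<Rightarrow> bool" for \<chi> where
  zero: "neg_rad \<chi> 0 \<zero>\<^bsub>Ut \<chi>\<^esub>"
| step: "\<lbrakk>a \<in> nonneg; a \<noteq> 0; Y \<in> Ut_minus \<chi>; Y \<in> Ut_degree \<chi> (- a);
    \<forall>i. a - \<alpha> i \<in> nonneg \<longrightarrow>
      (\<exists>Y1 Y2. neg_rad \<chi> (a - \<alpha> i) Y1 \<and> neg_rad \<chi> (a - \<alpha> i) Y2 \<and>
        commutator (Ut \<chi>) (tE \<chi> i) Y =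
          (Y1 \<otimes>\<^bsub>Ut \<chi>\<^esub> tK \<chi> (\<alpha> i)) \<oplus>\<^bsub>Ut \<chi>\<^esub> (Y2 \<otimes>\<^bsub>Ut \<chi>\<^esub> tL \<chi> (\<alpha> i)))\<rbrakk>
    \<Longrightarrow> neg_rad \<chi> a Y"

definition I_minus :: "('i, 'k::field) bichar \<Rightarrow> ('i, 'k) pre set set" where
  "I_minus \<chi> = kspan (Ut \<chi>) {Y. \<exists>a\<in>nonneg. neg_rad \<chi> a Y}"

definition J_minus :: "('i, 'k::field) bichar \<Rightarrow> ('i, 'k) pre set set" where
  "J_minus \<chi> = kspan (Ut \<chi>)
    {(y \<otimes>\<^bsub>Ut \<chi>\<^esub> z) \<otimes>\<^bsub>Ut \<chi>\<^esub> x |y z x. y \<in> I_minus \<chi> \<and> z \<in> Ut_zero \<chi> \<and> x \<in> Ut_plus \<chi>}"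

text \<open>Algebra homomorphisms out of \<^term>\<open>Ut \<chi>\<close> are determined on its carrier by their values on the
  generators, so this choice is unambiguous there; the map so determined is an automorphism.\<close>

definition Omega :: "('i, 'k::field) bichar \<Rightarrow> ('i, 'k) pre set \<Rightarrow> ('i, 'k) pre set" where
  "Omega \<chi> = (SOME h. h \<in> alg_hom (Ut \<chi>) (Ut \<chi>) \<and>
     (\<forall>a. h (tK \<chi> a) = tK \<chi> (- a)) \<and> (\<forall>a. h (tL \<chi> a) = tL \<chi> (- a)) \<and>
     (\<forall>i. h (tE \<chi> i) = tF \<chi> i \<otimes>\<^bsub>Ut \<chi>\<^esub> tL \<chi> (- \<alpha> i)) \<and>
     (\<forall>i. h (tF \<chi> i) = tK \<chi> (- \<alpha> i) \<otimes>\<^bsub>Ut \<chi>\<^esub> tE \<chi> i))"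


section \<open>The generalized quantum group\<close>

definition rad_ideal :: "('i, 'k::field) bichar \<Rightarrow> ('i, 'k) pre set set" where
  "rad_ideal \<chi> = J_minus \<chi> <+>\<^bsub>Ut \<chi>\<^esub> (Omega \<chi> ` J_minus \<chi>)"

definition U :: "('i, 'k::field) bichar \<Rightarrow> ('k, ('i, 'k) pre set set) module" where
  "U \<chi> = quot (Ut \<chi>) (rad_ideal \<chi>)"

definition to_U :: "('i, 'k::field) bichar \<Rightarrow> ('i, 'k) pre set \<Rightarrow> ('i, 'k) pre set set" where
  "to_U \<chi> x = rad_ideal \<chi> +>\<^bsub>Ut \<chi>\<^esub> x"

abbreviation uK :: "('i, 'k::field) bichar \<Rightarrow> 'i root_lattice \<Rightarrow> ('i, 'k) pre set set" where
  "uK \<chi> a \<equiv> to_U \<chi> (tK \<chi> a)"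
abbreviation uL :: "('i, 'k::field) bichar \<Rightarrow> 'i root_lattice \<Rightarrow> ('i, 'k) pre set set" where
  "uL \<chi> a \<equiv> to_U \<chi> (tL \<chi> a)"
abbreviation uE :: "('i, 'k::field) bichar \<Rightarrow> 'i \<Rightarrow> ('i, 'k) pre set set" where
  "uE \<chi> i \<equiv> to_U \<chi> (tE \<chi> i)"

text \<open>The parts \<open>U\<^sup>0\<close> and \<open>U\<^sup>-\<close> as algebras in their own right.\<close>

definition U_zero :: "('i, 'k::field) bichar \<Rightarrow> ('k, ('i, 'k) pre set set) module" where
  "U_zero \<chi> = U \<chi> \<lparr>carrier := to_U \<chi> ` Ut_zero \<chi>\<rparr>"

definition U_minus :: "('i, 'k::field) bichar \<Rightarrow> ('k, ('i, 'k) pre set set) module" where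
  "U_minus \<chi> = U \<chi> \<lparr>carrier := to_U \<chi> ` Ut_minus \<chi>\<rparr>"

definition U_minus_degree ::
    "('i, 'k::field) bichar \<Rightarrow> 'i root_lattice \<Rightarrow> ('i, 'k) pre set set set" where
  "U_minus_degree \<chi> a = carrier (U_minus \<chi>) \<inter> to_U \<chi> ` Ut_degree \<chi> a"


section \<open>Highest weight modules\<close>

type_synonym ('i, 'k) weight = "('i, 'k) pre set set \<Rightarrow> 'k"

text \<open>A character is only specified on the carrier of \<open>U\<^sup>0\<close>; its values elsewhere are arbitrary and
  never used.\<close>

definition Ch :: "('i, 'k::field) bichar \<Rightarrow> ('i, 'k) weight set" where
  "Ch \<chi> = alg_hom (U_zero \<chi>) scalar_alg"

text \<open>The Verma module is the quotient of \<open>U\<close> by the left ideal forced by the relations of the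
  highest weight vector \<open>v\<close>, which is the class of \<open>1\<close>.  That \<open>Y \<mapsto> Y v\<close> is a bijection from
  \<open>U\<^sup>-\<close> is a consequence of the triangular decomposition.\<close>

definition verma_ideal ::
    "('i, 'k::field) bichar \<Rightarrow> ('i, 'k) weight \<Rightarrow> ('i, 'k) pre set set set" where
  "verma_ideal \<chi> \<Lambda> = left_submodule_gen (U \<chi>) (regular_module (U \<chi>))
     (range (uE \<chi>) \<union> {z \<ominus>\<^bsub>U \<chi>\<^esub> (\<Lambda> z \<odot>\<^bsub>U \<chi>\<^esub> \<one>\<^bsub>U \<chi>\<^esub>) |z. z \<in> carrier (U_zero \<chi>)})"

definition verma :: "('i, 'k::field) bichar \<Rightarrow> ('i, 'k) weight \<Rightarrow>
    (('i, 'k) pre set set, ('i, 'k) pre set set set) module" where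
  "verma \<chi> \<Lambda> = quot (regular_module (U \<chi>)) (verma_ideal \<chi> \<Lambda>)"

definition verma_vec ::
    "('i, 'k::field) bichar \<Rightarrow> ('i, 'k) weight \<Rightarrow> ('i, 'k) pre set set set" where
  "verma_vec \<chi> \<Lambda> = verma_ideal \<chi> \<Lambda> +>\<^bsub>regular_module (U \<chi>)\<^esub> \<one>\<^bsub>U \<chi>\<^esub>"

definition verma_degree :: "('i, 'k::field) bichar \<Rightarrow> ('i, 'k) weight \<Rightarrow> 'i root_lattice \<Rightarrow>
    ('i, 'k) pre set set set set" where
  "verma_degree \<chi> \<Lambda> a = (\<lambda>y. y \<odot>\<^bsub>verma \<chi> \<Lambda>\<^esub> verma_vec \<chi> \<Lambda>) ` U_minus_degree \<chi> a"

text \<open>A submodule is graded if it is spanned by its homogeneous elements.\<close>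

definition proper_graded_submodule ::
    "('i, 'k::field) bichar \<Rightarrow> ('i, 'k) weight \<Rightarrow> ('i, 'k) pre set set set set \<Rightarrow> bool" where
  "proper_graded_submodule \<chi> \<Lambda> N \<longleftrightarrow>
     left_submodule (U \<chi>) (verma \<chi> \<Lambda>) N \<and> N \<noteq> carrier (verma \<chi> \<Lambda>) \<and>
     N = kspan (restrict_scalars (U \<chi>) (verma \<chi> \<Lambda>)) (\<Union>a. N \<inter> verma_degree \<chi> \<Lambda> a)"

definition max_submodule ::
    "('i, 'k::field) bichar \<Rightarrow> ('i, 'k) weight \<Rightarrow> ('i, 'k) pre set set set set" where
  "max_submodule \<chi> \<Lambda> = (GREATEST N. proper_graded_submodule \<chi> \<Lambda> N)"

definition simple_module :: "('i, 'k::field) bichar \<Rightarrow> ('i, 'k) weight \<Rightarrow>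
    (('i, 'k) pre set set, ('i, 'k) pre set set set set) module" where
  "simple_module \<chi> \<Lambda> = quot (verma \<chi> \<Lambda>) (max_submodule \<chi> \<Lambda>)"

end

theory Submission
  imports Defs
begin

text \<open>
  Write \<open>q = \<chi>(\<alpha>\<^sub>1, \<alpha>\<^sub>1)\<close> and \<open>[n] = 1 + q + \<dots> + q\<^sup>n\<^sup>-\<^sup>1\<close>.  If \<open>[m] = 0\<close> for some \<open>m > 0\<close>, then
  \<open>F\<^sup>n\<close> lies in the radical for all \<open>n \<ge> m\<close> and \<open>U\<^sup>-\<close> is finite-dimensional; so the hypothesis forces
  \<open>[n] \<noteq> 0\<close> for all \<open>n > 0\<close>, and then the radical vanishes.  On the Verma module
  \<open>E F\<^sup>n v = c\<^sub>n F\<^sup>n\<^sup>-\<^sup>1 v\<close> with \<open>c\<^sub>n = [n] (\<Lambda>(L) - q\<^sup>1\<^sup>-\<^sup>n \<Lambda>(K))\<close>, and its maximal graded submodule is spanned by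
  the \<open>F\<^sup>n v\<close> with \<open>c\<^sub>1 \<cdots> c\<^sub>n = 0\<close>.  Hence the simple quotient is finite-dimensional iff some
  \<open>c\<^sub>r\<^sub>+\<^sub>1\<close> vanishes, that is, iff \<open>\<Lambda>(K L\<^sup>-\<^sup>1) = q\<^sup>r\<close>.  Linear independence of the \<open>F\<^sup>n v\<close>, and with it
  the vanishing of the radical, is read off from explicit representations on sequences
  \<open>nat \<Rightarrow> 'k\<close>, so that no triangular decomposition is needed.
\<close>

section \<open>Free algebras\<close>

text \<open>That a zero of [m] makes U^- finite-dimensional only requires the radical to be a
  subspace. Once all [n] are nonzero the radical is 0, so classes in \<open>U\<close> and in
  \<open>Ut\<close> agree, and products in \<open>U\<close> are computed without a general proof
  that the radical is an ideal. The obstacle in showing that the radical is 0 is that [E, F^n]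
  involves K and L with separate coefficients, while a highest weight representation sees only one
  linear combination of them. Two weights whose values on K differ by a sign separate the
  coefficients, at the cost of a division by 2. The left ideal defining the Verma module is given by
  generators only. It is identified with the annihilator of (1, 0, 0, ...) in the sequence
  representation of weight \<Lambda>: the relations show that the powers of F span, the
  representation shows that they are independent. After that, equality in the module is equality of
  coordinates, and the relevant submodules are conditions on coordinates.\<close>

lemma free_alg_induct [case_names single add]:
  fixes f :: "'w \<Rightarrow>\<^sub>0 'k::comm_monoid_add"
  assumes "\<And>w c. P (Poly_Mapping.single w c)" and "\<And>f g. P f \<Longrightarrow> P g \<Longrightarrow> P (f + g)"
  shows "P f"
proof (induction f rule: update_induct)
  case const
  then show ?case using assms(1)[of undefined 0] by simp
next
  case (update f a b)
  have "Poly_Mapping.update a b f = f + Poly_Mapping.single a b"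
    using update(1) by (intro poly_mapping_eqI)
      (auto simp: lookup_update lookup_add lookup_single in_keys_iff)
  then show ?case using update assms by simp
qed

lemma scal_commute: "f * scal c = scal c * (f :: ('g, 'k::field) free_alg)"
  by (induction f rule: free_alg_induct) (simp_all add: mult_single algebra_simps)

lemma scal_left_commute: "f * (scal c * g) = scal c * (f * (g :: ('g, 'k::field) free_alg))"
  by (metis mult.assoc scal_commute)

lemma scal_scal: "scal a * (scal b * f) = scal (a * b) * (f :: ('g, 'k::field) free_alg)"
  by (simp add: mult_single flip: mult.assoc)

lemma scal_minus: "scal (- c) = - (scal c :: ('g, 'k::field) free_alg)"
  by (rule single_uminus)

lemma lookup_scal_mult:
  "Poly_Mapping.lookup (scal c * f) w = c * Poly_Mapping.lookup (f :: ('g, 'k::field) free_alg) w"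
proof (induction f rule: free_alg_induct)
  case (single v d)
  then show ?case by (simp add: mult_single lookup_single when_def)
qed (simp add: algebra_simps lookup_add)

lemma single_Cons:
  "Poly_Mapping.single (Word (g # w)) (c::'k::field) = free_gen g * Poly_Mapping.single (Word w) c"
  by (simp add: free_gen_def mult_single plus_free_word_def)

lemma single_Nil: "Poly_Mapping.single (Word []) c = scal c"
  by (simp add: zero_free_word_def)

text \<open>Every monomial arises from a constant by left multiplication with letters. This reduces
  statements about the action of an arbitrary element to the action of one generator.\<close>

lemma free_alg_gen_induct [case_names scal add gen]:
  fixes f :: "('g, 'k::field) free_alg"
  assumes "\<And>c. P (scal c)" and "\<And>f h. P f \<Longrightarrow> P h \<Longrightarrow> P (f + h)"
    and "\<And>g f. P f \<Longrightarrow> P (free_gen g * f)"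
  shows "P f"
proof (induction f rule: free_alg_induct)
  case (single w c)
  show ?case
  proof (cases w)
    case (Word l)
    have "P (Poly_Mapping.single (Word l) c)"
      by (induction l) (simp_all add: single_Cons single_Nil assms)
    then show ?thesis by (simp add: Word)
  qed
qed (rule assms(2))

text \<open>The coefficient is an argument of \<open>\<phi>\<close> because the target carries only
  an addition; each use supplies its own scalar multiplication.\<close>

definition lin_ext :: "('w \<Rightarrow> 'k \<Rightarrow> 'b) \<Rightarrow> ('w \<Rightarrow>\<^sub>0 'k::comm_monoid_add) \<Rightarrow> 'b::comm_monoid_add" where
  "lin_ext \<phi> f = (\<Sum>w\<in>Poly_Mapping.keys f. \<phi> w (Poly_Mapping.lookup f w))"

lemma lin_ext_single: "\<phi> w 0 = 0 \<Longrightarrow> lin_ext \<phi> (Poly_Mapping.single w c) = \<phi> w c"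
  by (simp add: lin_ext_def)

lemma lin_ext_add:
  assumes "\<And>w. \<phi> w 0 = 0" and "\<And>w a b. \<phi> w (a + b) = \<phi> w a + \<phi> w b"
  shows "lin_ext \<phi> (f + g) = lin_ext \<phi> f + lin_ext \<phi> g"
  unfolding lin_ext_def using assms by (intro setsum_keys_plus_distrib)

definition alg_lift ::
    "('g \<Rightarrow> ('h, 'k) free_alg) \<Rightarrow> ('g, 'k::field) free_alg \<Rightarrow> ('h, 'k) free_alg" where
  "alg_lift \<omega> = lin_ext (\<lambda>w c. scal c * prod_list (map \<omega> (letters w)))"

lemma alg_lift_single:
  "alg_lift \<omega> (Poly_Mapping.single w c) = scal c * prod_list (map \<omega> (letters w))"
  by (simp add: alg_lift_def lin_ext_single)

lemma alg_lift_add: "alg_lift \<omega> (f + g) = alg_lift \<omega> f + alg_lift \<omega> g"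
  unfolding alg_lift_def by (rule lin_ext_add) (simp_all add: single_add algebra_simps)

lemma alg_lift_gen: "alg_lift \<omega> (free_gen g) = \<omega> g"
  by (simp add: free_gen_def alg_lift_single)

lemma alg_lift_scal: "alg_lift \<omega> (scal c) = scal c"
  by (simp add: alg_lift_single zero_free_word_def)

lemma alg_lift_0: "alg_lift \<omega> 0 = 0"
  by (simp add: alg_lift_def lin_ext_def)

lemma alg_lift_1: "alg_lift \<omega> 1 = 1"
  using alg_lift_scal[of \<omega> 1] by simp

lemma alg_lift_minus: "alg_lift \<omega> (f - g) = alg_lift \<omega> f - alg_lift \<omega> g"
  using alg_lift_add[of \<omega> "f - g" g] by (simp add: algebra_simps)

lemma alg_lift_mult: "alg_lift \<omega> (f * g) = alg_lift \<omega> f * alg_lift \<omega> g"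
proof (induction f rule: free_alg_induct)
  case (single w c)
  show ?case
  proof (induction g rule: free_alg_induct)
    case (single v d)
    show ?case
      by (simp add: mult_single alg_lift_single plus_free_word_def mult.assoc
          scal_left_commute[of "prod_list _"] flip: scal_scal)
  qed (simp add: algebra_simps alg_lift_add)
qed (simp add: algebra_simps alg_lift_add)

section \<open>Quotients of presented structures\<close>

text \<open>All carriers below are iterated sets of cosets.  Each one is handled through a surjection \<open>\<pi>\<close>
  from a type-class group (in the end always the free algebra), which moves computations there.\<close>

locale presented =
  fixes M :: "('c, 'm, 'z) module_scheme" and \<pi> :: "'a::ab_group_add \<Rightarrow> 'm"
  assumes carrier_eq: "carrier M = range \<pi>"
    and add_eq: "\<pi> x \<oplus>\<^bsub>M\<^esub> \<pi> y = \<pi> (x + y)"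
    and zero_eq: "\<zero>\<^bsub>M\<^esub> = \<pi> 0"
begin

lemma carrier_obtain:
  assumes "X \<in> carrier M" obtains x where "X = \<pi> x"
  using assms carrier_eq by auto

lemma mem_carrier [simp]: "\<pi> x \<in> carrier M"
  by (simp add: carrier_eq)

lemma abelian_group: "abelian_group M"
proof (rule abelian_groupI)
  fix X assume "X \<in> carrier M"
  then obtain x where "X = \<pi> x" by (rule carrier_obtain)
  then have "\<pi> (- x) \<oplus>\<^bsub>M\<^esub> X = \<zero>\<^bsub>M\<^esub>" by (simp add: add_eq zero_eq)
  then show "\<exists>Y\<in>carrier M. Y \<oplus>\<^bsub>M\<^esub> X = \<zero>\<^bsub>M\<^esub>" by (intro bexI[of _ "\<pi> (- x)"]) simp_all
qed (auto simp: carrier_eq add_eq zero_eq ac_simps)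

lemma uminus_eq: "\<ominus>\<^bsub>M\<^esub> \<pi> x = \<pi> (- x)"
proof -
  interpret abelian_group M by (rule abelian_group)
  show ?thesis by (rule minus_equality) (simp_all add: add_eq zero_eq)
qed

lemma minus_eq: "\<pi> x \<ominus>\<^bsub>M\<^esub> \<pi> y = \<pi> (x - y)"
  by (simp add: a_minus_def uminus_eq add_eq)

lemma eq_iff: "\<pi> x = \<pi> y \<longleftrightarrow> \<pi> (x - y) = \<zero>\<^bsub>M\<^esub>"
proof
  assume "\<pi> x = \<pi> y"
  then have "\<pi> (x - y) = \<pi> (y - y)" by (metis minus_eq)
  then show "\<pi> (x - y) = \<zero>\<^bsub>M\<^esub>" by (simp add: zero_eq)
next
  assume "\<pi> (x - y) = \<zero>\<^bsub>M\<^esub>"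
  then have "\<pi> (x - y) \<oplus>\<^bsub>M\<^esub> \<pi> y = \<pi> 0 \<oplus>\<^bsub>M\<^esub> \<pi> y" by (simp add: zero_eq)
  then show "\<pi> x = \<pi> y" by (simp add: add_eq)
qed

end

text \<open>\<open>N\<close> is only an additive subgroup here, so the locale fits two-sided ideals,
  left ideals and submodules, and also \<open>rad_ideal\<close> before any closure under products is
  known. Stability under further operations is a premise of the individual quotient lemmas.\<close>

locale presented_quot = presented M \<pi>
  for M :: "('c, 'm, 'z) module_scheme" and \<pi> :: "'a::ab_group_add \<Rightarrow> 'm" +
  fixes N :: "'m set"
  assumes sub: "N \<subseteq> carrier M"
    and zero_mem: "\<pi> 0 \<in> N"
    and diff_mem: "\<pi> x \<in> N \<Longrightarrow> \<pi> y \<in> N \<Longrightarrow> \<pi> (x - y) \<in> N"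
begin

lemma uminus_mem: "\<pi> x \<in> N \<Longrightarrow> \<pi> (- x) \<in> N"
  using diff_mem[of 0 x] zero_mem by simp

lemma add_mem: "\<pi> x \<in> N \<Longrightarrow> \<pi> y \<in> N \<Longrightarrow> \<pi> (x + y) \<in> N"
  using diff_mem[of x "- y"] uminus_mem by simp

lemma coset_eq: "N +>\<^bsub>M\<^esub> \<pi> x = \<pi> ` {y. \<pi> (y - x) \<in> N}"
proof (intro equalityI subsetI)
  fix Y assume "Y \<in> N +>\<^bsub>M\<^esub> \<pi> x"
  then obtain h where h: "h \<in> N" "Y = h \<oplus>\<^bsub>M\<^esub> \<pi> x" by (auto simp: a_r_coset_def')
  with sub obtain z where "h = \<pi> z" by (auto simp: carrier_eq)
  with h show "Y \<in> \<pi> ` {y. \<pi> (y - x) \<in> N}"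
    by (intro image_eqI[of _ _ "z + x"]) (auto simp: add_eq)
next
  fix Y assume "Y \<in> \<pi> ` {y. \<pi> (y - x) \<in> N}"
  then obtain y where y: "Y = \<pi> y" "\<pi> (y - x) \<in> N" by auto
  then have "Y = \<pi> (y - x) \<oplus>\<^bsub>M\<^esub> \<pi> x" by (simp add: add_eq)
  with y(2) show "Y \<in> N +>\<^bsub>M\<^esub> \<pi> x" unfolding a_r_coset_def' by blast
qed

lemma coset_self: "\<pi> x \<in> N +>\<^bsub>M\<^esub> \<pi> x"
  unfolding coset_eq using zero_mem by auto

lemma mem_coset: "\<pi> y \<in> N +>\<^bsub>M\<^esub> \<pi> x \<longleftrightarrow> \<pi> (y - x) \<in> N"
proof
  assume "\<pi> y \<in> N +>\<^bsub>M\<^esub> \<pi> x"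
  then obtain z where "\<pi> y = \<pi> z" "\<pi> (z - x) \<in> N" by (auto simp: coset_eq)
  then show "\<pi> (y - x) \<in> N" by (metis minus_eq)
qed (auto simp: coset_eq)

lemma coset_iff: "N +>\<^bsub>M\<^esub> \<pi> x = N +>\<^bsub>M\<^esub> \<pi> y \<longleftrightarrow> \<pi> (x - y) \<in> N"
proof
  assume "N +>\<^bsub>M\<^esub> \<pi> x = N +>\<^bsub>M\<^esub> \<pi> y"
  then show "\<pi> (x - y) \<in> N" using coset_self[of x] by (simp add: mem_coset)
next
  assume d: "\<pi> (x - y) \<in> N"
  have "\<pi> (z - x) \<in> N \<longleftrightarrow> \<pi> (z - y) \<in> N" for z
    using add_mem[OF _ d, of "z - x"] diff_mem[OF _ d, of "z - y"] by auto
  then show "N +>\<^bsub>M\<^esub> \<pi> x = N +>\<^bsub>M\<^esub> \<pi> y" by (simp add: coset_eq)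
qed

lemma coset_zero: "N +>\<^bsub>M\<^esub> \<pi> 0 = N"
  using sub by (auto simp: coset_eq carrier_eq)

lemma presented_quotient: "presented (quot M N) (\<lambda>x. N +>\<^bsub>M\<^esub> \<pi> x)"
proof
  show "carrier (quot M N) = range (\<lambda>x. N +>\<^bsub>M\<^esub> \<pi> x)"
    by (auto simp: quot_def FactRing_def A_RCOSETS_def' carrier_eq)
  show "\<zero>\<^bsub>quot M N\<^esub> = N +>\<^bsub>M\<^esub> \<pi> 0"
    by (simp add: quot_def FactRing_def coset_zero)
  fix x y
  have "(N +>\<^bsub>M\<^esub> \<pi> x) <+>\<^bsub>M\<^esub> (N +>\<^bsub>M\<^esub> \<pi> y) = N +>\<^bsub>M\<^esub> \<pi> (x + y)"
  proof (intro equalityI subsetI)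
    fix Z assume "Z \<in> (N +>\<^bsub>M\<^esub> \<pi> x) <+>\<^bsub>M\<^esub> (N +>\<^bsub>M\<^esub> \<pi> y)"
    then obtain a b where ab: "\<pi> (a - x) \<in> N" "\<pi> (b - y) \<in> N" "Z = \<pi> (a + b)"
      by (auto simp: set_add_def' coset_eq add_eq)
    then show "Z \<in> N +>\<^bsub>M\<^esub> \<pi> (x + y)"
      using add_mem[OF ab(1,2)] by (simp add: mem_coset algebra_simps)
  next
    fix Z assume "Z \<in> N +>\<^bsub>M\<^esub> \<pi> (x + y)"
    then obtain z where z: "Z = \<pi> z" "\<pi> (z - (x + y)) \<in> N" by (auto simp: coset_eq)
    then have "\<pi> (z - y) \<in> N +>\<^bsub>M\<^esub> \<pi> x" "Z = \<pi> (z - y) \<oplus>\<^bsub>M\<^esub> \<pi> y"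
      by (simp_all add: mem_coset add_eq algebra_simps)
    then show "Z \<in> (N +>\<^bsub>M\<^esub> \<pi> x) <+>\<^bsub>M\<^esub> (N +>\<^bsub>M\<^esub> \<pi> y)"
      using coset_self[of y] by (auto simp: set_add_def')
  qed
  then show "(N +>\<^bsub>M\<^esub> \<pi> x) \<oplus>\<^bsub>quot M N\<^esub> (N +>\<^bsub>M\<^esub> \<pi> y) = N +>\<^bsub>M\<^esub> \<pi> (x + y)"
    by (simp add: quot_def FactRing_def)
qed

text \<open>The scalar multiplication of a quotient is a union over all members of a coset;
  stability of \<open>N\<close> under \<open>s\<close> makes all these cosets equal. The map
  \<open>s\<close> covers both field scalars and left multiplication by an algebra element.\<close>

lemma smult_quotient:
  assumes "\<And>x. c \<odot>\<^bsub>M\<^esub> \<pi> x = \<pi> (s x)"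
    and "\<And>x y. s (x - y) = s x - s y"
    and "\<And>x. \<pi> x \<in> N \<Longrightarrow> \<pi> (s x) \<in> N"
  shows "c \<odot>\<^bsub>quot M N\<^esub> (N +>\<^bsub>M\<^esub> \<pi> x) = N +>\<^bsub>M\<^esub> \<pi> (s x)"
proof -
  have "N +>\<^bsub>M\<^esub> (c \<odot>\<^bsub>M\<^esub> Y) = N +>\<^bsub>M\<^esub> \<pi> (s x)" if Y: "Y \<in> N +>\<^bsub>M\<^esub> \<pi> x" for Y
  proof -
    from Y obtain y where "Y = \<pi> y" "\<pi> (y - x) \<in> N" by (auto simp: coset_eq)
    then show ?thesis using assms(3)[of "y - x"] by (simp add: assms(1,2) coset_iff)
  qed
  then show ?thesis using coset_self[of x] by (auto simp: quot_def)
qed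

end

text \<open>Independence of the representatives comes from ab - xy = (a - x)b + x(b - y), where both
  summands lie in \<open>N\<close>.\<close>

lemma (in presented_quot) mult_quotient:
  fixes mul :: "'a \<Rightarrow> 'a \<Rightarrow> 'a"
  assumes "\<And>x y. \<pi> x \<otimes>\<^bsub>M\<^esub> \<pi> y = \<pi> (mul x y)"
    and "\<And>x y z. mul (x - y) z = mul x z - mul y z" "\<And>x y z. mul z (x - y) = mul z x - mul z y"
    and "\<And>x y. \<pi> x \<in> N \<Longrightarrow> \<pi> (mul x y) \<in> N" "\<And>x y. \<pi> x \<in> N \<Longrightarrow> \<pi> (mul y x) \<in> N"
  shows "(N +>\<^bsub>M\<^esub> \<pi> x) \<otimes>\<^bsub>quot M N\<^esub> (N +>\<^bsub>M\<^esub> \<pi> y) = N +>\<^bsub>M\<^esub> \<pi> (mul x y)"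
proof -
  have "N +>\<^bsub>M\<^esub> (A \<otimes>\<^bsub>M\<^esub> B) = N +>\<^bsub>M\<^esub> \<pi> (mul x y)"
    if AB: "A \<in> N +>\<^bsub>M\<^esub> \<pi> x" "B \<in> N +>\<^bsub>M\<^esub> \<pi> y" for A B
  proof -
    from AB obtain a b where ab: "A = \<pi> a" "\<pi> (a - x) \<in> N" "B = \<pi> b" "\<pi> (b - y) \<in> N"
      by (auto simp: coset_eq)
    have "mul a b - mul x y = mul (a - x) b + mul x (b - y)" by (simp add: assms(2,3))
    with ab show ?thesis
      using add_mem[OF assms(4)[OF ab(2), of b] assms(5)[OF ab(4), of x]]
      by (simp add: assms(1) coset_iff)
  qed
  then show ?thesis using coset_self[of x] coset_self[of y]
    by (auto simp: quot_def FactRing_def rcoset_mult_def)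
qed

section \<open>Vector spaces presented by a free algebra: spans and finite dimension\<close>

locale presented_space = presented M \<pi>
  for M :: "('k::field, 'm, 'z) module_scheme" and \<pi> :: "('g, 'k) free_alg \<Rightarrow> 'm" +
  assumes smult_eq: "c \<odot>\<^bsub>M\<^esub> \<pi> x = \<pi> (scal c * x)"
begin

lemma vectorspace: "vectorspace class_ring M"
proof -
  show ?thesis
  proof (rule vs_criteria)
    show "field (class_ring :: 'k ring)" by (rule class_field)
    show "\<forall>v\<in>carrier M. \<exists>w\<in>carrier M. v \<oplus>\<^bsub>M\<^esub> w = \<zero>\<^bsub>M\<^esub>"
    proof
      fix v assume "v \<in> carrier M"
      then obtain x where "v = \<pi> x" by (rule carrier_obtain)
      then show "\<exists>w\<in>carrier M. v \<oplus>\<^bsub>M\<^esub> w = \<zero>\<^bsub>M\<^esub>"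
        by (intro bexI[of _ "\<pi> (- x)"]) (simp_all add: add_eq zero_eq)
    qed
  qed (safe elim!: carrier_obtain,
      simp_all add: add_eq smult_eq zero_eq distrib_left distrib_right scal_scal single_add add_ac)
qed

lemma module: "module class_ring M"
  using vectorspace by (simp add: vectorspace_def)

lemma finite_dim_iff:
  "finite_dim M \<longleftrightarrow> (\<exists>A. finite A \<and> A \<subseteq> carrier M \<and> kspan M A = carrier M)"
  using vectorspace.fin_dim_def[OF vectorspace] by simp

lemma span_least:
  assumes "S \<subseteq> N" "N \<subseteq> carrier M" "\<zero>\<^bsub>M\<^esub> \<in> N"
    and "\<And>x y. \<pi> x \<in> N \<Longrightarrow> \<pi> y \<in> N \<Longrightarrow> \<pi> (x + y) \<in> N"
    and "\<And>c x. \<pi> x \<in> N \<Longrightarrow> \<pi> (scal c * x) \<in> N"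
  shows "kspan M S \<subseteq> N"
proof (rule module.span_is_subset[OF module assms(1)])
  show "submodule class_ring N M"
  proof (rule submodule.intro)
    show "v \<oplus>\<^bsub>M\<^esub> w \<in> N" if "v \<in> N" "w \<in> N" for v w
    proof -
      from that assms(2) obtain x y where "v = \<pi> x" "w = \<pi> y" by (metis carrier_obtain subsetD)
      with that assms(4) show ?thesis by (simp add: add_eq)
    qed
    show "c \<odot>\<^bsub>M\<^esub> v \<in> N" if "v \<in> N" for c v
    proof -
      from that assms(2) obtain x where "v = \<pi> x" by (metis carrier_obtain subsetD)
      with that assms(5) show ?thesis by (simp add: smult_eq)
    qed
    show "module class_ring M" "N \<subseteq> carrier M" "\<zero>\<^bsub>M\<^esub> \<in> N" by (fact module assms(2,3))+
  qed
qed

lemma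
  assumes S: "S \<subseteq> carrier M"
  shows span_incl: "s \<in> S \<Longrightarrow> s \<in> kspan M S"
    and span_sub: "kspan M S \<subseteq> carrier M"
    and span_zero: "\<zero>\<^bsub>M\<^esub> \<in> kspan M S"
    and span_add: "\<pi> x \<in> kspan M S \<Longrightarrow> \<pi> y \<in> kspan M S \<Longrightarrow> \<pi> (x + y) \<in> kspan M S"
    and span_smult: "\<pi> x \<in> kspan M S \<Longrightarrow> \<pi> (scal c * x) \<in> kspan M S"
proof -
  interpret span: submodule class_ring "kspan M S" M
    by (rule module.span_is_submodule[OF module S])
  show "s \<in> S \<Longrightarrow> s \<in> kspan M S" using module.in_own_span[OF module S] by auto
  show "kspan M S \<subseteq> carrier M" by (rule span.subset)
  show "\<zero>\<^bsub>M\<^esub> \<in> kspan M S" by simp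
  show "\<pi> x \<in> kspan M S \<Longrightarrow> \<pi> y \<in> kspan M S \<Longrightarrow> \<pi> (x + y) \<in> kspan M S"
    using span.m_closed[of "\<pi> x" "\<pi> y"] by (simp add: add_eq)
  show "\<pi> x \<in> kspan M S \<Longrightarrow> \<pi> (scal c * x) \<in> kspan M S"
    using span.smult_closed[of c "\<pi> x"] by (simp add: smult_eq)
qed

end

section \<open>The algebra before the quotient by the radicals\<close>

lemma ring_free_algebra: "ring (free_algebra :: ('k::field, ('g, 'k) free_alg) module)"
proof (rule ringI)
  show "abelian_group (free_algebra :: ('k, ('g, 'k) free_alg) module)"
  proof (rule abelian_groupI)
    fix x :: "('g, 'k) free_alg"
    show "\<exists>y\<in>carrier free_algebra. y \<oplus>\<^bsub>free_algebra\<^esub> x = \<zero>\<^bsub>free_algebra\<^esub>"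
      by (intro bexI[of _ "- x"]) (simp_all add: free_algebra_def)
  qed (simp_all add: free_algebra_def add.assoc add.commute)
  show "Group.monoid (free_algebra :: ('k, ('g, 'k) free_alg) module)"
    by (rule Group.monoidI) (simp_all add: free_algebra_def mult.assoc)
qed (simp_all add: free_algebra_def algebra_simps)

lemma presented_space_free_algebra: "presented_space free_algebra (\<lambda>f. f)"
  by unfold_locales (simp_all add: free_algebra_def)

lemma a_inv_free_algebra: "\<ominus>\<^bsub>free_algebra\<^esub> f = - f"
  using presented.uminus_eq[OF presented_space.axioms(1)[OF presented_space_free_algebra]] .

lemma ideal_free_algebraI:
  assumes "P 0" and "\<And>f g. P f \<Longrightarrow> P g \<Longrightarrow> P (f - g)"
    and "\<And>f g. P f \<Longrightarrow> P (g * f)" and "\<And>f g. P f \<Longrightarrow> P (f * g)"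
  shows "ideal {f. P f} free_algebra"
proof (rule idealI[OF ring_free_algebra])
  interpret ring free_algebra by (rule ring_free_algebra)
  show "subgroup {f. P f} (add_monoid free_algebra)"
  proof (rule add.subgroupI)
    show "\<ominus>\<^bsub>free_algebra\<^esub> f \<in> {f. P f}" if "f \<in> {f. P f}" for f
      using that assms(2)[OF assms(1), of f] by (simp add: a_inv_free_algebra)
    show "f \<oplus>\<^bsub>free_algebra\<^esub> g \<in> {f. P f}" if "f \<in> {f. P f}" "g \<in> {f. P f}" for f g
      using that assms(2)[of f "0 - g"] assms(2)[OF assms(1), of g] by (simp add: free_algebra_def)
  qed (use assms(1) in \<open>auto simp: free_algebra_def\<close>)
qed (use assms in \<open>auto simp: free_algebra_def\<close>)

context
  fixes \<chi> :: "('i, 'k::field) bichar"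
begin

lemma ideal_rel_ideal: "ideal (rel_ideal \<chi>) free_algebra"
  unfolding rel_ideal_def by (rule ring.genideal_ideal[OF ring_free_algebra]) (simp add: free_algebra_def)

lemma relators_in: "r \<in> relators \<chi> \<Longrightarrow> r \<in> rel_ideal \<chi>"
  unfolding rel_ideal_def
  using ring.genideal_self[OF ring_free_algebra, of "relators \<chi>"] by (auto simp: free_algebra_def)

text \<open>The elements satisfying \<open>P\<close> form a two-sided ideal containing the relators,
  and \<open>rel_ideal\<close> is the least one. This is the way to show that a map on the free
  algebra respects the relations.\<close>

lemma rel_ideal_induct [consumes 1, case_names zero diff mult_left mult_right relator]:
  assumes "f \<in> rel_ideal \<chi>" "P 0" and "\<And>f g. P f \<Longrightarrow> P g \<Longrightarrow> P (f - g)"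
    and "\<And>f g. P f \<Longrightarrow> P (g * f)" and "\<And>f g. P f \<Longrightarrow> P (f * g)" and "\<And>r. r \<in> relators \<chi> \<Longrightarrow> P r"
  shows "P f"
proof -
  have "rel_ideal \<chi> \<subseteq> {f. P f}" unfolding rel_ideal_def
    by (rule ring.genideal_minimal[OF ring_free_algebra ideal_free_algebraI]) (use assms in auto)
  with assms(1) show ?thesis by auto
qed

lemma
  shows rel_ideal_0: "0 \<in> rel_ideal \<chi>"
    and rel_ideal_diff: "f \<in> rel_ideal \<chi> \<Longrightarrow> g \<in> rel_ideal \<chi> \<Longrightarrow> f - g \<in> rel_ideal \<chi>"
    and rel_ideal_mult_left: "f \<in> rel_ideal \<chi> \<Longrightarrow> h * f \<in> rel_ideal \<chi>"
    and rel_ideal_mult_right: "f \<in> rel_ideal \<chi> \<Longrightarrow> f * h \<in> rel_ideal \<chi>"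
proof -
  interpret ideal "rel_ideal \<chi>" free_algebra by (rule ideal_rel_ideal)
  interpret F: presented_space free_algebra "\<lambda>f. f" by (rule presented_space_free_algebra)
  show "0 \<in> rel_ideal \<chi>"
    using additive_subgroup.zero_closed[OF is_additive_subgroup] by (simp add: F.zero_eq)
  have add: "f + g \<in> rel_ideal \<chi>" if "f \<in> rel_ideal \<chi>" "g \<in> rel_ideal \<chi>" for f g
    using additive_subgroup.a_closed[OF is_additive_subgroup that] by (simp add: F.add_eq)
  show "f \<in> rel_ideal \<chi> \<Longrightarrow> g \<in> rel_ideal \<chi> \<Longrightarrow> f - g \<in> rel_ideal \<chi>"
    using add[of f "- g"] additive_subgroup.a_inv_closed[OF is_additive_subgroup, of g]
    by (simp add: F.uminus_eq)
  show "f \<in> rel_ideal \<chi> \<Longrightarrow> h * f \<in> rel_ideal \<chi>"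
    using I_l_closed[of f h] by (simp add: free_algebra_def)
  show "f \<in> rel_ideal \<chi> \<Longrightarrow> f * h \<in> rel_ideal \<chi>"
    using I_r_closed[of f h] by (simp add: free_algebra_def)
qed

lemma presented_quot_rel_ideal: "presented_quot free_algebra (\<lambda>f. f) (rel_ideal \<chi>)"
proof -
  interpret F: presented_space free_algebra "\<lambda>f. f" by (rule presented_space_free_algebra)
  show ?thesis
    by unfold_locales (auto simp: rel_ideal_0 rel_ideal_diff free_algebra_def)
qed

lemma presented_space_Ut: "presented_space (Ut \<chi>) (to_Ut \<chi>)"
proof -
  interpret F: presented_quot free_algebra "\<lambda>f. f" "rel_ideal \<chi>" by (rule presented_quot_rel_ideal)
  interpret Q: presented "quot free_algebra (rel_ideal \<chi>)" "\<lambda>f. rel_ideal \<chi> +>\<^bsub>free_algebra\<^esub> f"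
    by (rule F.presented_quotient)
  have "presented_space (quot free_algebra (rel_ideal \<chi>)) (\<lambda>f. rel_ideal \<chi> +>\<^bsub>free_algebra\<^esub> f)"
    by unfold_locales
      (rule F.smult_quotient, auto simp: free_algebra_def algebra_simps rel_ideal_mult_left)
  then show ?thesis by (simp add: Ut_def to_Ut_def[abs_def])
qed

lemma Ut_mult: "to_Ut \<chi> f \<otimes>\<^bsub>Ut \<chi>\<^esub> to_Ut \<chi> g = to_Ut \<chi> (f * g)"
proof -
  interpret F: presented_quot free_algebra "\<lambda>f. f" "rel_ideal \<chi>" by (rule presented_quot_rel_ideal)
  show ?thesis unfolding Ut_def to_Ut_def
    by (rule F.mult_quotient)
      (auto simp: free_algebra_def algebra_simps rel_ideal_mult_left rel_ideal_mult_right)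
qed

lemma Ut_one: "\<one>\<^bsub>Ut \<chi>\<^esub> = to_Ut \<chi> 1"
  by (simp add: Ut_def to_Ut_def quot_def FactRing_def free_algebra_def)

lemma to_Ut_eq_iff: "to_Ut \<chi> f = to_Ut \<chi> g \<longleftrightarrow> f - g \<in> rel_ideal \<chi>"
  using presented_quot.coset_iff[OF presented_quot_rel_ideal] by (simp add: to_Ut_def)

lemma to_Ut_mult_cong:
  "to_Ut \<chi> f = to_Ut \<chi> f' \<Longrightarrow> to_Ut \<chi> g = to_Ut \<chi> g' \<Longrightarrow> to_Ut \<chi> (f * g) = to_Ut \<chi> (f' * g')"
  by (simp flip: Ut_mult)

lemma to_Ut_add_cong:
  "to_Ut \<chi> f = to_Ut \<chi> f' \<Longrightarrow> to_Ut \<chi> g = to_Ut \<chi> g' \<Longrightarrow> to_Ut \<chi> (f + g) = to_Ut \<chi> (f' + g')"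
  by (simp flip: presented.add_eq[OF presented_space.axioms(1)[OF presented_space_Ut]])

lemma to_Ut_diff_cong:
  "to_Ut \<chi> f = to_Ut \<chi> f' \<Longrightarrow> to_Ut \<chi> g = to_Ut \<chi> g' \<Longrightarrow> to_Ut \<chi> (f - g) = to_Ut \<chi> (f' - g')"
  by (simp flip: presented.minus_eq[OF presented_space.axioms(1)[OF presented_space_Ut]])

text \<open>The relations that move a \<open>K\<close> or an \<open>L\<close> past another generator
  all have this shape, and the scalars multiply along products and powers.\<close>

definition qcomm :: "'k \<Rightarrow> ('i, 'k) pre \<Rightarrow> ('i, 'k) pre \<Rightarrow> bool" where
  "qcomm c x y \<longleftrightarrow> to_Ut \<chi> (x * y) = to_Ut \<chi> (scal c * (y * x))"

lemma qcomm_mult_right: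
  assumes "qcomm c x y" "qcomm d x z" shows "qcomm (c * d) x (y * z)"
proof -
  have "to_Ut \<chi> (x * (y * z)) = to_Ut \<chi> (scal c * (y * x) * z)"
    using to_Ut_mult_cong[OF assms(1)[unfolded qcomm_def] refl[of "to_Ut \<chi> z"]] by (simp add: mult.assoc)
  also have "\<dots> = to_Ut \<chi> (scal c * y * (scal d * (z * x)))"
    using to_Ut_mult_cong[OF refl[of "to_Ut \<chi> (scal c * y)"] assms(2)[unfolded qcomm_def]]
    by (simp add: mult.assoc)
  also have "scal c * y * (scal d * (z * x)) = scal (c * d) * (y * z * x)"
    by (simp add: mult.assoc scal_left_commute[of y] flip: scal_scal)
  finally show ?thesis by (simp add: qcomm_def)
qed

lemma qcomm_power: "qcomm c x y \<Longrightarrow> qcomm (c ^ n) x (y ^ n)"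
  by (induction n) (simp add: qcomm_def, simp add: qcomm_mult_right)

lemma
  shows rel_K0: "to_Ut \<chi> (fK 0) = to_Ut \<chi> 1"
    and rel_L0: "to_Ut \<chi> (fL 0) = to_Ut \<chi> 1"
    and rel_KK: "to_Ut \<chi> (fK a * fK b) = to_Ut \<chi> (fK (a + b))"
    and rel_LL: "to_Ut \<chi> (fL a * fL b) = to_Ut \<chi> (fL (a + b))"
    and rel_KL: "qcomm 1 (fK a) (fL b)"
    and rel_KE: "qcomm (\<chi> a (\<alpha> i)) (fK a) (fE i)"
    and rel_LE: "qcomm (\<chi> (- \<alpha> i) a) (fL a) (fE i)"
    and rel_KF: "qcomm (\<chi> a (- \<alpha> i)) (fK a) (fF i)"
    and rel_LF: "qcomm (\<chi> (\<alpha> i) a) (fL a) (fF i)"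
    and rel_EF: "to_Ut \<chi> (fE i * fF j - fF j * fE i) =
      to_Ut \<chi> (if i = j then - fK (\<alpha> i) + fL (\<alpha> i) else 0)"
proof -
  show "to_Ut \<chi> (fE i * fF j - fF j * fE i) =
      to_Ut \<chi> (if i = j then - fK (\<alpha> i) + fL (\<alpha> i) else 0)"
    unfolding to_Ut_eq_iff by (intro relators_in relators.intros)
qed (unfold qcomm_def to_Ut_eq_iff, auto intro: relators_in relators.intros)

lemma qcomm_LK: "qcomm 1 (fL b) (fK a)"
  using rel_KL[of a b] by (simp add: qcomm_def)

lemma rel_KK_diff: "qcomm 1 (fK a) (fK b)" and rel_LL_diff: "qcomm 1 (fL a) (fL b)"
  by (simp_all add: qcomm_def rel_KK rel_LL add.commute)

end

section \<open>The automorphism Omega\<close>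

fun omega_gen :: "'i qgen \<Rightarrow> ('i, 'k::field) pre" where
  "omega_gen (GK a) = fK (- a)"
| "omega_gen (GL a) = fL (- a)"
| "omega_gen (GE i) = fF i * fL (- \<alpha> i)"
| "omega_gen (GF i) = fK (- \<alpha> i) * fE i"

context
  fixes \<chi> :: "('i, 'k::field) bichar"
  assumes bihom: "bihom \<chi>"
begin

lemma chi_nonzero: "\<chi> a b \<noteq> 0"
  and chi_add_right: "\<chi> a (b + c) = \<chi> a b * \<chi> a c"
  and chi_add_left: "\<chi> (a + b) c = \<chi> a c * \<chi> b c"
  using bihom by (simp_all add: bihom_def)

lemma chi_0_right: "\<chi> a 0 = 1" and chi_0_left: "\<chi> 0 a = 1"
  using chi_add_right[of a 0 0] chi_add_left[of 0 0 a] chi_nonzero by simp_all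

lemma chi_minus_right: "\<chi> a (- b) = inverse (\<chi> a b)"
  using chi_add_right[of a b "- b"] chi_nonzero[of a b]
  by (simp add: chi_0_right field_simps)

lemma chi_minus_left: "\<chi> (- a) b = inverse (\<chi> a b)"
  using chi_add_left[of a "- a" b] chi_nonzero[of a b]
  by (simp add: chi_0_left field_simps)

lemmas chi_simps = chi_minus_left chi_minus_right chi_0_left chi_0_right

text \<open>This is the \<open>E\<close>-\<open>F\<close> relation after substitution. Moving L past
  KE on the left side costs \<open>d\<close>, and exchanging F with K gives the same
  \<open>d\<close> back, so the left side becomes -K [E, F] L for the generators of indices
  \<open>j\<close> and \<open>i\<close>; for equal indices K and L of opposite degree
  cancel.\<close>

lemma omega_EF:
  "to_Ut \<chi> (fF i * fL (- \<alpha> i) * (fK (- \<alpha> j) * fE j) - fK (- \<alpha> j) * fE j * (fF i * fL (- \<alpha> i))) =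
   to_Ut \<chi> (if i = j then - fK (- \<alpha> i) + fL (- \<alpha> i) else 0)"
proof -
  let ?L = "fL (- \<alpha> i) :: ('i, 'k) pre" and ?K = "fK (- \<alpha> j) :: ('i, 'k) pre"
  let ?F = "fF i :: ('i, 'k) pre" and ?E = "fE j :: ('i, 'k) pre"
  define d where "d = \<chi> (- \<alpha> j) (- \<alpha> i)"
  note cong = to_Ut_mult_cong
  have L: "qcomm \<chi> d ?L (?K * ?E)"
    using qcomm_mult_right[OF qcomm_LK[of \<chi> "- \<alpha> i" "- \<alpha> j"] rel_LE[of \<chi> j "- \<alpha> i"]] by (simp add: d_def)
  have "to_Ut \<chi> (?F * ?L * (?K * ?E)) = to_Ut \<chi> (?F * (scal d * (?K * ?E * ?L)))"
    using cong[OF refl[of "to_Ut \<chi> ?F"] L[unfolded qcomm_def]] by (simp add: mult.assoc)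
  also have "?F * (scal d * (?K * ?E * ?L)) = (scal d * (?F * ?K)) * (?E * ?L)"
    by (simp add: mult.assoc scal_left_commute[of ?F])
  also have "to_Ut \<chi> \<dots> = to_Ut \<chi> ((?K * ?F) * (?E * ?L))"
    by (rule cong) (simp_all add: rel_KF[unfolded qcomm_def] d_def)
  finally have 1: "to_Ut \<chi> (?F * ?L * (?K * ?E) - ?K * ?E * (?F * ?L)) =
      to_Ut \<chi> ((?K * ?F) * (?E * ?L) - ?K * ?E * (?F * ?L))"
    by (rule to_Ut_diff_cong) (rule refl)
  have 2: "(?K * ?F) * (?E * ?L) - ?K * ?E * (?F * ?L) = 0 - ?K * (?E * ?F - ?F * ?E) * ?L"
    by (simp add: algebra_simps)
  have 3: "to_Ut \<chi> (0 - ?K * (?E * ?F - ?F * ?E) * ?L) =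
      to_Ut \<chi> (0 - ?K * (if j = i then - fK (\<alpha> j) + fL (\<alpha> j) else 0) * ?L)"
    by (intro to_Ut_diff_cong cong refl rel_EF)
  show ?thesis
  proof (cases "i = j")
    case False
    with 1 2 3 show ?thesis by auto
  next
    case True
    have "to_Ut \<chi> ((?K * fK (\<alpha> j)) * ?L - ?K * (fL (\<alpha> j) * ?L)) = to_Ut \<chi> (1 * ?L - ?K * 1)"
      by (intro to_Ut_diff_cong cong refl)
        (simp_all add: rel_KK rel_LL rel_K0 rel_L0 True)
    moreover have "0 - ?K * (- fK (\<alpha> j) + fL (\<alpha> j)) * ?L = (?K * fK (\<alpha> j)) * ?L - ?K * (fL (\<alpha> j) * ?L)"
      by (simp add: algebra_simps)
    ultimately show ?thesis using 1 2 3 True by simp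
  qed
qed

lemma omega_relator:
  assumes "r \<in> relators \<chi>" shows "alg_lift omega_gen r \<in> rel_ideal \<chi>"
proof -
  note lift = alg_lift_minus alg_lift_add alg_lift_mult alg_lift_gen alg_lift_scal alg_lift_1 alg_lift_0
  note q = qcomm_def[THEN iffD1, unfolded to_Ut_eq_iff]
  from assms show ?thesis
  proof cases
    case 1
    then show ?thesis using rel_K0[of \<chi>] by (simp add: lift to_Ut_eq_iff)
  next
    case 2
    then show ?thesis using rel_L0[of \<chi>] by (simp add: lift to_Ut_eq_iff)
  next
    case (3 a b)
    then show ?thesis using rel_KK[of \<chi> "- a" "- b"] by (simp add: lift to_Ut_eq_iff)
  next
    case (4 a b)
    then show ?thesis using rel_LL[of \<chi> "- a" "- b"] by (simp add: lift to_Ut_eq_iff)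
  next
    case (5 a b)
    then show ?thesis using rel_KL[of \<chi> "- a" "- b"] by (simp add: lift qcomm_def to_Ut_eq_iff)
  next
    case (6 a i)
    then show ?thesis
      using qcomm_mult_right[OF rel_KF[of \<chi> "- a" i] rel_KL[of \<chi> "- a" "- \<alpha> i"]]
      by (simp add: lift qcomm_def to_Ut_eq_iff chi_simps)
  next
    case (7 a i)
    then show ?thesis
      using qcomm_mult_right[OF rel_LF[of \<chi> i "- a"] rel_LL_diff[of \<chi> "- a" "- \<alpha> i"]]
      by (simp add: lift qcomm_def to_Ut_eq_iff chi_simps)
  next
    case (8 a i)
    then show ?thesis
      using qcomm_mult_right[OF rel_KK_diff[of \<chi> "- a" "- \<alpha> i"] rel_KE[of \<chi> "- a" i]]
      by (simp add: lift qcomm_def to_Ut_eq_iff chi_simps)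
  next
    case (9 a i)
    then show ?thesis
      using qcomm_mult_right[OF qcomm_LK[of \<chi> "- a" "- \<alpha> i"] rel_LE[of \<chi> i "- a"]]
      by (simp add: lift qcomm_def to_Ut_eq_iff chi_simps)
  next
    case (10 i j)
    have "alg_lift omega_gen (- fK (\<alpha> i) + fL (\<alpha> i)) = (- fK (- \<alpha> i) + fL (- \<alpha> i) :: ('i, 'k) pre)"
      using alg_lift_minus[of omega_gen "fL (\<alpha> i) :: ('i, 'k) pre" "fK (\<alpha> i)"] by (simp add: lift)
    with 10 omega_EF[of i j] show ?thesis by (simp add: lift to_Ut_eq_iff split: if_splits)
  qed
qed

lemma omega_rel_ideal: "f \<in> rel_ideal \<chi> \<Longrightarrow> alg_lift omega_gen f \<in> rel_ideal \<chi>"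
  by (induction rule: rel_ideal_induct)
    (auto simp: alg_lift_0 alg_lift_minus alg_lift_mult omega_relator
      rel_ideal_0 rel_ideal_diff rel_ideal_mult_left rel_ideal_mult_right)

text \<open>\<open>Omega\<close> is a choice, so its properties depend on existence. The
  substitution \<open>alg_lift omega_gen\<close> preserves the relation ideal, hence descends to
  cosets independently of the chosen representative.\<close>

lemma Omega_alg_hom: "Omega \<chi> \<in> alg_hom (Ut \<chi>) (Ut \<chi>)"
proof -
  interpret T: presented_space "Ut \<chi>" "to_Ut \<chi>" by (rule presented_space_Ut)
  define h where "h X = to_Ut \<chi> (alg_lift omega_gen (SOME f. to_Ut \<chi> f = X))" for X
  have h: "h (to_Ut \<chi> f) = to_Ut \<chi> (alg_lift omega_gen f)" for f
  proof -
    have "to_Ut \<chi> (SOME g. to_Ut \<chi> g = to_Ut \<chi> f) = to_Ut \<chi> f" by (rule someI) simp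
    then show ?thesis
      using omega_rel_ideal by (simp add: h_def to_Ut_eq_iff flip: alg_lift_minus)
  qed
  have "h \<in> alg_hom (Ut \<chi>) (Ut \<chi>)"
    unfolding alg_hom_def Ring.ring_hom_def
    by (auto elim!: T.carrier_obtain simp: h T.add_eq T.smult_eq Ut_mult Ut_one
        alg_lift_1 alg_lift_add alg_lift_mult alg_lift_scal)
  then have "\<exists>h. h \<in> alg_hom (Ut \<chi>) (Ut \<chi>) \<and>
     (\<forall>a. h (tK \<chi> a) = tK \<chi> (- a)) \<and> (\<forall>a. h (tL \<chi> a) = tL \<chi> (- a)) \<and>
     (\<forall>i. h (tE \<chi> i) = tF \<chi> i \<otimes>\<^bsub>Ut \<chi>\<^esub> tL \<chi> (- \<alpha> i)) \<and>
     (\<forall>i. h (tF \<chi> i) = tK \<chi> (- \<alpha> i) \<otimes>\<^bsub>Ut \<chi>\<^esub> tE \<chi> i)"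
    by (intro exI[of _ h]) (simp add: h alg_lift_gen Ut_mult)
  from someI_ex[OF this] show ?thesis unfolding Omega_def by blast
qed

end

section \<open>Rank one\<close>

locale rank_one =
  fixes \<chi> :: "('i, 'k::field_char_0) bichar" and i1 :: 'i
  assumes bihom: "bihom \<chi>" and only: "i = i1"
begin

definition q :: 'k where "q = \<chi> (\<alpha> i1) (\<alpha> i1)"

definition qnum :: "nat \<Rightarrow> 'k" where "qnum n = (\<Sum>j<n. q ^ j)"

text \<open>The q-number at q^-1. It is the coefficient of K in [E, F^n], since K picks up q^-1 on
  passing F where L picks up q.\<close>

definition qnum' :: "nat \<Rightarrow> 'k" where "qnum' n = (\<Sum>j<n. inverse q ^ j)"

abbreviation E :: "('i, 'k) pre" where "E \<equiv> fE i1"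
abbreviation F :: "('i, 'k) pre" where "F \<equiv> fF i1"
abbreviation K1 :: "('i, 'k) pre" where "K1 \<equiv> fK (\<alpha> i1)"
abbreviation L1 :: "('i, 'k) pre" where "L1 \<equiv> fL (\<alpha> i1)"

lemma q_nonzero: "q \<noteq> 0"
  by (simp add: q_def chi_nonzero[OF bihom])

lemma chi_alpha:
  "\<chi> (\<alpha> i1) (- \<alpha> i1) = inverse q" "\<chi> (- \<alpha> i1) (\<alpha> i1) = inverse q" "\<chi> (\<alpha> i1) (\<alpha> i1) = q"
  by (simp_all add: q_def chi_simps[OF bihom])

text \<open>The factor q^n reverses the order of the summands. This is the source of the power of q
  that appears in the final criterion.\<close>

lemma qnum'_eq: "qnum' (Suc n) * q ^ n = qnum (Suc n)"
proof -
  have "qnum' (Suc n) * q ^ n = (\<Sum>j<Suc n. q ^ (n - j))"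
    unfolding qnum'_def sum_distrib_right
    by (intro sum.cong refl) (simp add: q_nonzero power_diff power_inverse field_simps)
  also have "\<dots> = qnum (Suc n)"
    unfolding qnum_def using sum.nat_diff_reindex[of "\<lambda>j. q ^ j" "Suc n"] by simp
  finally show ?thesis .
qed

lemma qnum'_zero_iff: "qnum' n = 0 \<longleftrightarrow> qnum n = 0"
proof (cases n)
  case 0
  then show ?thesis by (simp add: qnum_def qnum'_def)
next
  case (Suc m)
  then show ?thesis using qnum'_eq[of m] q_nonzero by (metis mult_eq_0_iff power_not_zero)
qed

text \<open>E is moved through one F at a time: E F^(n+1) = [E, F] F^n + F (E F^n). The K and L
  produced by [E, F] pass F^n with the factors q^-n and q^n, which are the new last summands of the
  two q-numbers.\<close>

lemma E_F_power:
  "to_Ut \<chi> (E * F ^ n) =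
   to_Ut \<chi> (F ^ n * E + F ^ (n - 1) * (scal (qnum n) * L1 - scal (qnum' n) * K1))"
proof (induction n)
  case 0
  show ?case by (simp add: qnum_def qnum'_def)
next
  case (Suc n)
  let ?B = "\<lambda>n. scal (qnum n) * L1 - scal (qnum' n) * K1"
  have K: "to_Ut \<chi> (K1 * F ^ n) = to_Ut \<chi> (scal (inverse q ^ n) * (F ^ n * K1))"
    using qcomm_power[OF rel_KF[of \<chi> "\<alpha> i1" i1]] by (simp add: qcomm_def chi_alpha)
  have L: "to_Ut \<chi> (L1 * F ^ n) = to_Ut \<chi> (scal (q ^ n) * (F ^ n * L1))"
    using qcomm_power[OF rel_LF[of \<chi> i1 "\<alpha> i1"]] by (simp add: qcomm_def chi_alpha)
  have EF: "to_Ut \<chi> (E * F - F * E) = to_Ut \<chi> (- K1 + L1)"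
    using rel_EF[of \<chi> i1 i1] by simp
  have "to_Ut \<chi> (E * F ^ Suc n) = to_Ut \<chi> ((E * F - F * E) * F ^ n + F * (E * F ^ n))"
    by (simp add: algebra_simps)
  also have "\<dots> = to_Ut \<chi> ((- K1 + L1) * F ^ n + F * (F ^ n * E + F ^ (n - 1) * ?B n))"
    by (intro to_Ut_add_cong to_Ut_mult_cong refl EF Suc.IH)
  also have "(- K1 + L1) * F ^ n = L1 * F ^ n - K1 * F ^ n"
    by (simp add: algebra_simps)
  also have "to_Ut \<chi> (L1 * F ^ n - K1 * F ^ n + F * (F ^ n * E + F ^ (n - 1) * ?B n)) =
      to_Ut \<chi> (scal (q ^ n) * (F ^ n * L1) - scal (inverse q ^ n) * (F ^ n * K1) +
        F * (F ^ n * E + F ^ (n - 1) * ?B n))"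
    by (intro to_Ut_add_cong to_Ut_diff_cong refl K L)
  \<comment> \<open>For \<open>n = 0\<close> the truncated exponent breaks the power law, but then
    both q-numbers are 0 and the bracket vanishes.\<close>
  also have "F * (F ^ n * E + F ^ (n - 1) * ?B n) = F ^ Suc n * E + F ^ n * ?B n"
  proof (cases n)
    case 0
    then show ?thesis by (simp add: qnum_def qnum'_def)
  qed (simp add: distrib_left mult.assoc)
  also have "scal (q ^ n) * (F ^ n * L1) - scal (inverse q ^ n) * (F ^ n * K1) +
      (F ^ Suc n * E + F ^ n * ?B n) = F ^ Suc n * E + F ^ n * ?B (Suc n)"
    unfolding scal_left_commute[of "F ^ n", symmetric]
    by (simp add: qnum_def qnum'_def single_add algebra_simps)
  finally show ?case by simp
qed

section \<open>Polynomials in F and the negative part\<close>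

definition Fw :: "nat \<Rightarrow> 'i qgen free_word" where
  "Fw n = Word (replicate n (GF i1))"

lemma Fw_add: "Fw m + Fw n = Fw (m + n)"
  by (simp add: Fw_def plus_free_word_def replicate_add)

lemma Fw_eq_iff [simp]: "Fw m = Fw n \<longleftrightarrow> m = n"
  by (simp add: Fw_def)

lemma F_power: "F ^ n = Poly_Mapping.single (Fw n) 1"
proof (induction n)
  case 0
  show ?case by (simp add: Fw_def single_Nil)
next
  case (Suc n)
  then show ?case by (simp add: Fw_def single_Cons)
qed

lemma single_Fw: "Poly_Mapping.single (Fw n) c = scal c * F ^ n"
  by (simp add: F_power mult_single)

text \<open>The projection of the free algebra onto the polynomials in F that drops every other
  monomial. It does not descend to \<open>Ut\<close>; its purpose is that its range supplies
  representatives, for the negative part and later for the Verma module.\<close>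

definition nf :: "('i, 'k) pre \<Rightarrow> ('i, 'k) pre" where
  "nf = lin_ext (\<lambda>w c. if w \<in> range Fw then Poly_Mapping.single w c else 0)"

lemma nf_single: "nf (Poly_Mapping.single w c) = (if w \<in> range Fw then Poly_Mapping.single w c else 0)"
  unfolding nf_def by (subst lin_ext_single) auto

lemma nf_add: "nf (f + g) = nf f + nf g"
  unfolding nf_def by (rule lin_ext_add) (auto simp: single_add)

lemma nf_0 [simp]: "nf 0 = 0"
  using nf_add[of 0 0] by simp

lemma nf_diff: "nf (f - g) = nf f - nf g"
  using nf_add[of "f - g" g] by (simp add: algebra_simps)

lemma nf_scal: "nf (scal c * f) = scal c * nf f"
  by (induction f rule: free_alg_induct) (auto simp: mult_single nf_single nf_add algebra_simps)

lemma nf_nf: "nf (nf f) = nf f"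
  by (induction f rule: free_alg_induct) (auto simp: nf_single nf_add)

lemma nf_F_power [simp]: "nf (F ^ n) = F ^ n"
  by (simp add: F_power nf_single)

lemma nf_induct [case_names power add]:
  assumes "\<And>n c. P (scal c * F ^ n)" and "\<And>f g. P f \<Longrightarrow> P g \<Longrightarrow> P (f + g)"
  shows "P (nf f)"
proof (induction f rule: free_alg_induct)
  case (single w c)
  then show ?case using assms(1)[of 0 0] assms(1) by (auto simp: nf_single single_Fw)
qed (simp add: nf_add assms(2))

lemma nf_mult: "nf (nf f * nf g) = nf f * nf g"
proof (induction f rule: nf_induct)
  case (power n c)
  show ?case
  proof (induction g rule: nf_induct)
    case (power m d)
    show ?case by (simp add: mult_single Fw_add nf_single flip: single_Fw)
  qed (simp add: distrib_left nf_add)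
qed (simp add: distrib_right nf_add)

lemma keys_nf: "Poly_Mapping.keys (nf f) \<subseteq> range Fw"
proof (induction f rule: nf_induct)
  case (power n c)
  show ?case by (simp add: single_Fw[symmetric])
next
  case (add f g)
  then show ?case by (meson Un_least keys_add order_trans)
qed

text \<open>With a single index, the subalgebra generated by F consists of the polynomials in
  F.\<close>

lemma Ut_minus_eq: "Ut_minus \<chi> = range (\<lambda>f. to_Ut \<chi> (nf f))"
proof -
  interpret T: presented_space "Ut \<chi>" "to_Ut \<chi>" by (rule presented_space_Ut)
  have F: "tF \<chi> i = to_Ut \<chi> (nf F)" for i
    using only[of i] nf_F_power[of 1] by simp
  have one: "\<one>\<^bsub>Ut \<chi>\<^esub> = to_Ut \<chi> (nf 1)"
    using nf_F_power[of 0] by (simp add: Ut_one)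
  show ?thesis
  proof (intro equalityI subsetI)
    fix X assume "X \<in> Ut_minus \<chi>"
    then show "X \<in> range (\<lambda>f. to_Ut \<chi> (nf f))"
      unfolding Ut_minus_def
    proof (induction rule: subalg_gen.induct)
      case one
      show ?case using \<open>\<one>\<^bsub>Ut \<chi>\<^esub> = to_Ut \<chi> (nf 1)\<close> by blast
    next
      case (incl s)
      then show ?case using F by auto
    next
      case (add x y)
      then show ?case by (auto simp: T.add_eq simp flip: nf_add)
    next
      case (mult x y)
      then obtain f g where "x = to_Ut \<chi> (nf f)" "y = to_Ut \<chi> (nf g)" by auto
      then have "x \<otimes>\<^bsub>Ut \<chi>\<^esub> y = to_Ut \<chi> (nf (nf f * nf g))" by (simp add: Ut_mult nf_mult)
      then show ?case by blast
    next
      case (smult x c)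
      then show ?case by (auto simp: T.smult_eq simp flip: nf_scal)
    qed
  next
    fix X assume "X \<in> range (\<lambda>f. to_Ut \<chi> (nf f))"
    then obtain f where X: "X = to_Ut \<chi> (nf f)" by auto
    have "to_Ut \<chi> (F ^ n) \<in> Ut_minus \<chi>" for n
    proof (induction n)
      case 0
      show ?case unfolding Ut_minus_def using subalg_gen.one[of "Ut \<chi>"] by (simp add: Ut_one)
    next
      case (Suc n)
      have "tF \<chi> i1 \<in> Ut_minus \<chi>" unfolding Ut_minus_def by (rule subalg_gen.incl) simp
      then show ?case using Suc subalg_gen.mult[of "tF \<chi> i1" "Ut \<chi>" _ "to_Ut \<chi> (F ^ n)"]
        by (simp add: Ut_minus_def Ut_mult)
    qed
    then have "to_Ut \<chi> (nf f) \<in> Ut_minus \<chi>"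
      by (induction f rule: nf_induct)
        (auto simp: Ut_minus_def simp flip: T.smult_eq T.add_eq intro: subalg_gen.add subalg_gen.smult)
    then show "X \<in> Ut_minus \<chi>" by (simp add: X)
  qed
qed

end

section \<open>Highest weight representations on sequences\<close>

text \<open>\<open>\<kappa>\<close> and \<open>\<mu>\<close> are the values of a highest weight on K
  and L. Being arbitrary characters of the lattice, they allow auxiliary weights before anything is
  known about \<open>U\<close>.\<close>

locale rank_one_weight = rank_one \<chi> i1
  for \<chi> :: "('i, 'k::field_char_0) bichar" and i1 :: 'i +
  fixes \<kappa> \<mu> :: "'i root_lattice \<Rightarrow> 'k"
  assumes kappa_0: "\<kappa> 0 = 1" and kappa_add: "\<kappa> (a + b) = \<kappa> a * \<kappa> b"
    and mu_0: "\<mu> 0 = 1" and mu_add: "\<mu> (a + b) = \<mu> a * \<mu> b"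
begin

text \<open>The coefficient in E F^n v = \<open>cc n\<close> F^(n-1) v: each of the \<open>n\<close>
  commutators [E, F] = L - K met on the way contributes its eigenvalue on F^j v.\<close>

definition cc :: "nat \<Rightarrow> 'k" where
  "cc n = (\<Sum>j<n. \<mu> (\<alpha> i1) * q ^ j - \<kappa> (\<alpha> i1) * inverse q ^ j)"

lemma cc_eq: "cc n = \<mu> (\<alpha> i1) * qnum n - \<kappa> (\<alpha> i1) * qnum' n"
  by (simp add: cc_def qnum_def qnum'_def sum_subtractf sum_distrib_left)

text \<open>A sequence \<open>v\<close> stands for the formal sum of the \<open>v n\<close> F^n
  applied to the highest weight vector. The formulas give the coordinate at \<open>n\<close> of the
  result, so E reads the coordinate above and F the one below. Finite support is not
  imposed.\<close>

fun gact :: "'i qgen \<Rightarrow> (nat \<Rightarrow> 'k) \<Rightarrow> nat \<Rightarrow> 'k" where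
  "gact (GK a) v n = \<kappa> a * \<chi> a (- \<alpha> i1) ^ n * v n"
| "gact (GL a) v n = \<mu> a * \<chi> (\<alpha> i1) a ^ n * v n"
| "gact (GE i) v n = cc (Suc n) * v (Suc n)"
| "gact (GF i) v n = (case n of 0 \<Rightarrow> 0 | Suc m \<Rightarrow> v m)"

definition act :: "('i, 'k) pre \<Rightarrow> (nat \<Rightarrow> 'k) \<Rightarrow> nat \<Rightarrow> 'k" where
  "act f v n = lin_ext (\<lambda>w c. c * foldr gact (letters w) v n) f"

lemma act_single: "act (Poly_Mapping.single w c) v n = c * foldr gact (letters w) v n"
  unfolding act_def by (subst lin_ext_single) simp_all

lemma act_scal: "act (scal c) v n = c * v n"
  by (simp add: act_single zero_free_word_def)

lemma act_add: "act (f + g) v n = act f v n + act g v n"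
  unfolding act_def by (rule lin_ext_add) (simp_all add: distrib_right)

lemma act_0 [simp]: "act 0 v n = 0"
  using act_scal[of 0 v n] by simp

lemma act_1 [simp]: "act 1 v n = v n"
  using act_scal[of 1 v n] by simp

lemma act_diff: "act (f - g) v n = act f v n - act g v n"
  using act_add[of "f - g" g v n] by (simp add: algebra_simps)

lemma gact_linear: "gact g (\<lambda>m. c * v m + u m) n = c * gact g v n + gact g u n"
  by (cases g) (simp_all add: algebra_simps split: nat.split)

lemma act_gen_mult: "act (free_gen g * f) v n = gact g (act f v) n"
proof -
  have "act (free_gen g * f) v = gact g (act f v)"
  proof (induction f rule: free_alg_induct)
    case (single w c)
    have "free_gen g * Poly_Mapping.single w c = Poly_Mapping.single (Word (g # letters w)) c"
      by (simp add: single_Cons)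
    moreover have "act (Poly_Mapping.single w c) v = (\<lambda>m. c * foldr gact (letters w) v m + 0)"
      by (simp add: act_single fun_eq_iff)
    moreover have "gact g (\<lambda>m. 0) n = 0" for n by (cases g) (simp_all split: nat.split)
    ultimately show ?case by (simp only: act_single gact_linear) (simp add: act_single fun_eq_iff)
  next
    case (add f h)
    have "act (f + h) v = (\<lambda>m. 1 * act f v m + act h v m)" by (simp add: act_add fun_eq_iff)
    with add show ?case by (simp only: gact_linear) (simp add: distrib_left act_add fun_eq_iff)
  qed
  then show ?thesis by simp
qed

lemma act_gen: "act (free_gen g) v n = gact g v n"
proof -
  have "act 1 v = v" by (rule ext) simp
  then show ?thesis using act_gen_mult[of g 1 v n] by simp
qed

lemma act_scal_mult: "act (scal c * f) v n = c * act f v n"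
  by (induction f rule: free_alg_induct) (simp_all add: mult_single act_single act_add algebra_simps)

lemma act_mult: "act (f * g) v n = act f (act g v) n"
proof (induction f arbitrary: n rule: free_alg_gen_induct)
  case (gen h f)
  then have "act (f * g) v = act f (act g v)" by (rule ext)
  then show ?case by (simp add: mult.assoc act_gen_mult)
qed (simp_all add: act_scal act_scal_mult act_add distrib_right)

text \<open>The zero sequence is itself the result of acting with 0, so this is
  \<open>act_mult\<close> with second factor 0.\<close>

lemma act_zero_right: "act f (\<lambda>m. 0) = (\<lambda>n. 0)"
proof
  fix n
  have "act 0 e = (\<lambda>m. 0)" for e by (rule ext) simp
  then show "act f (\<lambda>m. 0) n = 0" using act_mult[of f 0 undefined n] by simp
qed

text \<open>The choice of \<open>cc\<close> matters only for [E, F] = L - K: the difference of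
  \<open>cc (Suc n)\<close> and \<open>cc n\<close> is the eigenvalue of L - K at coordinate
  \<open>n\<close>. At \<open>n = 0\<close> the product F E contributes nothing, in accordance with
  \<open>cc 0\<close> being an empty sum. The other relations follow from multiplicativity of
  \<open>\<kappa>\<close>, \<open>\<mu>\<close> and \<open>\<chi>\<close>.\<close>

lemma act_relator:
  assumes "r \<in> relators \<chi>" shows "act r v n = 0"
proof -
  note act_simps = act_diff act_scal_mult act_gen_mult act_gen act_add
  note chi = chi_nonzero[OF bihom] chi_add_right[OF bihom] chi_add_left[OF bihom] chi_simps[OF bihom]
  from assms show ?thesis
  proof cases
    case (6 a i)
    show ?thesis unfolding 6 using only[of i] by (simp add: act_simps chi field_simps)
  next
    case (7 a i)
    show ?thesis unfolding 7 using only[of i] by (simp add: act_simps chi field_simps)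
  next
    case (8 a i)
    show ?thesis unfolding 8 using only[of i] by (simp add: act_simps chi field_simps split: nat.split)
  next
    case (9 a i)
    show ?thesis unfolding 9 using only[of i] by (simp add: act_simps chi field_simps split: nat.split)
  next
    case (10 i j)
    have r: "r = (E * F - F * E) - (fL (\<alpha> i1) - fK (\<alpha> i1))"
      using 10 only[of i] only[of j] by simp
    show ?thesis unfolding r
      by (cases n) (simp_all add: act_simps cc_def chi_alpha power_inverse algebra_simps)
  qed (simp_all add: act_simps chi kappa_0 mu_0 kappa_add mu_add power_mult_distrib)
qed

lemma act_rel_ideal: "f \<in> rel_ideal \<chi> \<Longrightarrow> act f v = (\<lambda>n. 0)"
proof (induction arbitrary: v rule: rel_ideal_induct)
  case (mult_left f g)
  show ?case by (rule ext) (simp add: act_mult mult_left act_zero_right)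
next
  case (mult_right f g)
  show ?case by (rule ext) (simp add: act_mult mult_right)
qed (simp_all add: fun_eq_iff act_diff act_relator)

lemma act_to_Ut: "to_Ut \<chi> f = to_Ut \<chi> g \<Longrightarrow> act f v n = act g v n"
  using act_rel_ideal[of "f - g" v] by (simp add: to_Ut_eq_iff act_diff fun_eq_iff)

section \<open>The orbit of the highest weight vector\<close>

definition e0 :: "nat \<Rightarrow> 'k" where "e0 n = (if n = 0 then 1 else 0)"

lemma act_F_power: "act (F ^ m) e0 n = (if n = m then 1 else 0)"
proof (induction m arbitrary: n)
  case 0
  show ?case by (simp add: e0_def)
next
  case (Suc m)
  then show ?case by (simp add: act_gen_mult split: nat.split)
qed

lemma lookup_F_power: "Poly_Mapping.lookup (F ^ m) (Fw n) = (if n = m then 1 else 0)"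
  by (simp add: F_power lookup_single when_def)

text \<open>F^m sends \<open>e0\<close> to the m-th unit sequence, so acting on \<open>e0\<close>
  reads off coefficients. This is the linear independence of the powers of F modulo the
  relations.\<close>

lemma act_nf: "act (nf f) e0 n = Poly_Mapping.lookup (nf f) (Fw n)"
  by (induction f rule: nf_induct)
    (simp_all add: act_scal_mult act_F_power lookup_scal_mult lookup_F_power lookup_add act_add)

lemma nf_eq_0:
  assumes "\<And>n. act (nf f) e0 n = 0" shows "nf f = 0"
proof -
  have "Poly_Mapping.lookup (nf f) w = 0 \<or> w \<in> range Fw" for w
    using keys_nf[of f] by (auto simp: in_keys_iff)
  with assms show ?thesis by (intro poly_mapping_eqI) (auto simp: act_nf)
qed

text \<open>Each letter shifts the supporting coordinate by minus its degree, so a word that leads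
  from coordinate 0 to \<open>n\<close> must have degree -n.\<close>

lemma act_degree:
  assumes "\<forall>w\<in>Poly_Mapping.keys f. word_degree w = a" and "act f e0 n \<noteq> 0"
  shows "Poly_Mapping.lookup a i1 = - int n"
proof -
  have word: "foldr gact l e0 n \<noteq> 0 \<Longrightarrow> Poly_Mapping.lookup (word_degree (Word l)) i1 = - int n" for l n
  proof (induction l arbitrary: n)
    case Nil
    then show ?case by (simp add: e0_def word_degree_def split: if_splits)
  next
    case (Cons g l)
    have d: "Poly_Mapping.lookup (word_degree (Word (g # l))) i1 =
        Poly_Mapping.lookup (gen_degree g) i1 + Poly_Mapping.lookup (word_degree (Word l)) i1"
      by (simp add: word_degree_def lookup_add)
    show ?case
    proof (cases g)
      case (GE i)
      with Cons.prems Cons.IH[of "Suc n"] d only[of i] show ?thesis by (simp add: simple_root_def)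
    next
      case (GF i)
      with Cons d only[of i] show ?thesis by (cases n) (simp_all add: simple_root_def)
    qed (use Cons d in simp_all)
  qed
  from assms(2) obtain w where "w \<in> Poly_Mapping.keys f" "foldr gact (letters w) e0 n \<noteq> 0"
    unfolding act_def lin_ext_def by (metis (no_types, lifting) mult_not_zero sum.not_neutral_contains_not_neutral)
  with word[of "letters w" n] assms(1) show ?thesis by simp
qed

end

section \<open>The radicals\<close>

lemma (in presented_space) span_trivial:
  assumes "S \<subseteq> {\<zero>\<^bsub>M\<^esub>}" shows "kspan M S \<subseteq> {\<zero>\<^bsub>M\<^esub>}"
proof (rule span_least[OF assms])
  fix x y c assume x: "\<pi> x \<in> {\<zero>\<^bsub>M\<^esub>}"
  have "\<pi> (scal c * x) = c \<odot>\<^bsub>M\<^esub> \<pi> 0" using x by (simp add: zero_eq flip: smult_eq)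
  then show "\<pi> (scal c * x) \<in> {\<zero>\<^bsub>M\<^esub>}" by (simp add: smult_eq zero_eq)
  assume y: "\<pi> y \<in> {\<zero>\<^bsub>M\<^esub>}"
  have "\<pi> (x + y) = \<pi> 0 \<oplus>\<^bsub>M\<^esub> \<pi> 0" using x y by (simp add: zero_eq flip: add_eq)
  then show "\<pi> (x + y) \<in> {\<zero>\<^bsub>M\<^esub>}" by (simp add: add_eq zero_eq)
qed (simp_all add: zero_eq)

section \<open>The radical as a subspace, for any index type\<close>

context
  fixes \<chi> :: "('i, 'k::field) bichar"
begin

interpretation T: presented_space "Ut \<chi>" "to_Ut \<chi>" by (rule presented_space_Ut)

lemma subalg_gen_carrier:
  assumes "S \<subseteq> carrier (Ut \<chi>)" shows "subalg_gen (Ut \<chi>) S \<subseteq> carrier (Ut \<chi>)"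
proof
  fix X assume "X \<in> subalg_gen (Ut \<chi>) S"
  then show "X \<in> carrier (Ut \<chi>)"
    by (induction rule: subalg_gen.induct)
      (use assms in \<open>auto simp: T.carrier_eq Ut_one T.add_eq T.smult_eq Ut_mult\<close>)
qed

lemma Ut_parts_carrier: "Ut_zero \<chi> \<subseteq> carrier (Ut \<chi>)" "Ut_plus \<chi> \<subseteq> carrier (Ut \<chi>)"
  unfolding Ut_zero_def Ut_plus_def by (intro subalg_gen_carrier; auto)+

lemma neg_rad_carrier: "neg_rad \<chi> a Y \<Longrightarrow> Y \<in> carrier (Ut \<chi>)"
  by (induction rule: neg_rad.induct) (auto simp: T.zero_eq Ut_degree_def)

lemma I_minus_carrier: "I_minus \<chi> \<subseteq> carrier (Ut \<chi>)"
  unfolding I_minus_def by (rule T.span_sub) (auto simp: neg_rad_carrier)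

lemma J_minus_gens_carrier:
  "{(y \<otimes>\<^bsub>Ut \<chi>\<^esub> z) \<otimes>\<^bsub>Ut \<chi>\<^esub> x |y z x. y \<in> I_minus \<chi> \<and> z \<in> Ut_zero \<chi> \<and> x \<in> Ut_plus \<chi>} \<subseteq> carrier (Ut \<chi>)"
proof safe
  fix y z x assume "y \<in> I_minus \<chi>" "z \<in> Ut_zero \<chi>" "x \<in> Ut_plus \<chi>"
  then have "y \<in> carrier (Ut \<chi>)" "z \<in> carrier (Ut \<chi>)" "x \<in> carrier (Ut \<chi>)"
    using I_minus_carrier Ut_parts_carrier by blast+
  then show "(y \<otimes>\<^bsub>Ut \<chi>\<^esub> z) \<otimes>\<^bsub>Ut \<chi>\<^esub> x \<in> carrier (Ut \<chi>)"
    by (elim T.carrier_obtain) (simp add: Ut_mult)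
qed

lemmas J_minus_span = T.span_sub[OF J_minus_gens_carrier, folded J_minus_def]
  T.span_zero[OF J_minus_gens_carrier, folded J_minus_def]
  T.span_add[OF J_minus_gens_carrier, folded J_minus_def]
  T.span_smult[OF J_minus_gens_carrier, folded J_minus_def]

lemma I_minus_sub_J_minus: "I_minus \<chi> \<subseteq> J_minus \<chi>"
proof
  fix Y assume Y: "Y \<in> I_minus \<chi>"
  then obtain y where y: "Y = to_Ut \<chi> y" using I_minus_carrier by (auto simp: T.carrier_eq)
  have "\<one>\<^bsub>Ut \<chi>\<^esub> \<in> Ut_zero \<chi>" "\<one>\<^bsub>Ut \<chi>\<^esub> \<in> Ut_plus \<chi>"
    unfolding Ut_zero_def Ut_plus_def by (rule subalg_gen.one)+
  then have "(Y \<otimes>\<^bsub>Ut \<chi>\<^esub> \<one>\<^bsub>Ut \<chi>\<^esub>) \<otimes>\<^bsub>Ut \<chi>\<^esub> \<one>\<^bsub>Ut \<chi>\<^esub> \<in> J_minus \<chi>"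
    unfolding J_minus_def using Y by (intro T.span_incl[OF J_minus_gens_carrier]) blast
  then show "Y \<in> J_minus \<chi>" by (simp add: y Ut_one Ut_mult)
qed

lemma rad_ideal_iff: "Z \<in> rad_ideal \<chi> \<longleftrightarrow> (\<exists>X\<in>J_minus \<chi>. \<exists>Y\<in>J_minus \<chi>. Z = X \<oplus>\<^bsub>Ut \<chi>\<^esub> Omega \<chi> Y)"
  by (auto simp: rad_ideal_def set_add_def')

context
  assumes bihom: "bihom \<chi>"
begin

lemma
  shows Omega_carrier: "X \<in> carrier (Ut \<chi>) \<Longrightarrow> Omega \<chi> X \<in> carrier (Ut \<chi>)"
    and Omega_add: "X \<in> carrier (Ut \<chi>) \<Longrightarrow> Y \<in> carrier (Ut \<chi>) \<Longrightarrow>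
      Omega \<chi> (X \<oplus>\<^bsub>Ut \<chi>\<^esub> Y) = Omega \<chi> X \<oplus>\<^bsub>Ut \<chi>\<^esub> Omega \<chi> Y"
    and Omega_smult: "X \<in> carrier (Ut \<chi>) \<Longrightarrow> Omega \<chi> (c \<odot>\<^bsub>Ut \<chi>\<^esub> X) = c \<odot>\<^bsub>Ut \<chi>\<^esub> Omega \<chi> X"
  using Omega_alg_hom[OF bihom] by (auto simp: alg_hom_def Ring.ring_hom_def)

lemma Omega_zero: "Omega \<chi> \<zero>\<^bsub>Ut \<chi>\<^esub> = \<zero>\<^bsub>Ut \<chi>\<^esub>"
proof -
  obtain w where "Omega \<chi> (to_Ut \<chi> 0) = to_Ut \<chi> w"
    using Omega_carrier[of "to_Ut \<chi> 0"] by (auto simp: T.carrier_eq)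
  then show ?thesis using Omega_smult[of "to_Ut \<chi> 0" 0] by (simp add: T.smult_eq T.zero_eq)
qed

text \<open>The radical is the sum of a span and of its image under a map that is linear on the
  carrier; only the linear structure is established at this stage.\<close>

lemma
  shows rad_ideal_carrier: "rad_ideal \<chi> \<subseteq> carrier (Ut \<chi>)"
    and rad_ideal_zero: "to_Ut \<chi> 0 \<in> rad_ideal \<chi>"
    and J_minus_sub_rad: "J_minus \<chi> \<subseteq> rad_ideal \<chi>"
    and rad_ideal_add: "to_Ut \<chi> x \<in> rad_ideal \<chi> \<Longrightarrow> to_Ut \<chi> y \<in> rad_ideal \<chi> \<Longrightarrow> to_Ut \<chi> (x + y) \<in> rad_ideal \<chi>"
    and rad_ideal_smult: "to_Ut \<chi> x \<in> rad_ideal \<chi> \<Longrightarrow> to_Ut \<chi> (scal c * x) \<in> rad_ideal \<chi>"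
proof -
  have rep: "\<exists>x y w. Z = to_Ut \<chi> (x + w) \<and> to_Ut \<chi> x \<in> J_minus \<chi> \<and> to_Ut \<chi> y \<in> J_minus \<chi> \<and>
      Omega \<chi> (to_Ut \<chi> y) = to_Ut \<chi> w" if "Z \<in> rad_ideal \<chi>" for Z
  proof -
    from that obtain X Y where XY: "X \<in> J_minus \<chi>" "Y \<in> J_minus \<chi>" "Z = X \<oplus>\<^bsub>Ut \<chi>\<^esub> Omega \<chi> Y"
      by (auto simp: rad_ideal_iff)
    with J_minus_span(1) have "X \<in> carrier (Ut \<chi>)" "Y \<in> carrier (Ut \<chi>)" by auto
    moreover from this obtain x y w where "X = to_Ut \<chi> x" "Y = to_Ut \<chi> y" "Omega \<chi> Y = to_Ut \<chi> w"
      by (metis T.carrier_obtain Omega_carrier)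
    ultimately show ?thesis using XY by (metis T.add_eq)
  qed
  show "rad_ideal \<chi> \<subseteq> carrier (Ut \<chi>)" using rep by fastforce
  show J: "J_minus \<chi> \<subseteq> rad_ideal \<chi>"
  proof
    fix X assume X: "X \<in> J_minus \<chi>"
    with J_minus_span(1) obtain x where "X = to_Ut \<chi> x" by (auto simp: T.carrier_eq)
    then have "X = X \<oplus>\<^bsub>Ut \<chi>\<^esub> Omega \<chi> \<zero>\<^bsub>Ut \<chi>\<^esub>" by (simp add: Omega_zero[unfolded T.zero_eq] T.zero_eq T.add_eq)
    with X J_minus_span(2) show "X \<in> rad_ideal \<chi>" unfolding rad_ideal_iff by blast
  qed
  with J_minus_span(2) show "to_Ut \<chi> 0 \<in> rad_ideal \<chi>" by (auto simp: T.zero_eq)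
  show "to_Ut \<chi> (x + y) \<in> rad_ideal \<chi>" if "to_Ut \<chi> x \<in> rad_ideal \<chi>" "to_Ut \<chi> y \<in> rad_ideal \<chi>"
  proof -
    from rep[OF that(1)] rep[OF that(2)] obtain a b c a' b' c' where
      *: "to_Ut \<chi> x = to_Ut \<chi> (a + c)" "to_Ut \<chi> a \<in> J_minus \<chi>" "to_Ut \<chi> b \<in> J_minus \<chi>"
        "Omega \<chi> (to_Ut \<chi> b) = to_Ut \<chi> c" "to_Ut \<chi> y = to_Ut \<chi> (a' + c')" "to_Ut \<chi> a' \<in> J_minus \<chi>"
        "to_Ut \<chi> b' \<in> J_minus \<chi>" "Omega \<chi> (to_Ut \<chi> b') = to_Ut \<chi> c'" by metis
    then have "to_Ut \<chi> (x + y) = to_Ut \<chi> (a + a') \<oplus>\<^bsub>Ut \<chi>\<^esub> Omega \<chi> (to_Ut \<chi> (b + b'))"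
      using to_Ut_add_cong[OF *(1,5)] Omega_add[of "to_Ut \<chi> b" "to_Ut \<chi> b'"]
      by (simp add: T.add_eq add_ac)
    with * J_minus_span(3) show ?thesis unfolding rad_ideal_iff by blast
  qed
  show "to_Ut \<chi> (scal c * x) \<in> rad_ideal \<chi>" if "to_Ut \<chi> x \<in> rad_ideal \<chi>"
  proof -
    from rep[OF that] obtain a b d where
      *: "to_Ut \<chi> x = to_Ut \<chi> (a + d)" "to_Ut \<chi> a \<in> J_minus \<chi>" "to_Ut \<chi> b \<in> J_minus \<chi>"
        "Omega \<chi> (to_Ut \<chi> b) = to_Ut \<chi> d" by metis
    then have "to_Ut \<chi> (scal c * x) = to_Ut \<chi> (scal c * a) \<oplus>\<^bsub>Ut \<chi>\<^esub> Omega \<chi> (to_Ut \<chi> (scal c * b))"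
      using to_Ut_mult_cong[OF refl *(1)] Omega_smult[of "to_Ut \<chi> b" c]
      by (simp add: T.add_eq T.smult_eq distrib_left)
    with * J_minus_span(4) show ?thesis unfolding rad_ideal_iff by blast
  qed
qed

lemma presented_quot_rad_ideal: "presented_quot (Ut \<chi>) (to_Ut \<chi>) (rad_ideal \<chi>)"
proof
  fix x y assume "to_Ut \<chi> x \<in> rad_ideal \<chi>" "to_Ut \<chi> y \<in> rad_ideal \<chi>"
  then show "to_Ut \<chi> (x - y) \<in> rad_ideal \<chi>"
    using rad_ideal_add[of x "scal (- 1) * y"] rad_ideal_smult[of y "- 1"] by (simp add: scal_minus)
qed (use rad_ideal_carrier rad_ideal_zero in auto)

interpretation Q: presented_quot "Ut \<chi>" "to_Ut \<chi>" "rad_ideal \<chi>" by (rule presented_quot_rad_ideal)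

lemma presented_space_U: "presented_space (U \<chi>) (\<lambda>f. to_U \<chi> (to_Ut \<chi> f))"
  unfolding U_def to_U_def
  by (intro presented_space.intro presented_space_axioms.intro Q.presented_quotient Q.smult_quotient)
    (simp_all add: T.smult_eq rad_ideal_smult right_diff_distrib)

lemma to_U_eq_zero_iff: "to_U \<chi> (to_Ut \<chi> f) = \<zero>\<^bsub>U \<chi>\<^esub> \<longleftrightarrow> to_Ut \<chi> f \<in> rad_ideal \<chi>"
  using Q.coset_iff[of f 0] presented.zero_eq[OF presented_space.axioms(1)[OF presented_space_U]]
  by (simp add: to_U_def)

lemma U_one: "\<one>\<^bsub>U \<chi>\<^esub> = to_U \<chi> (to_Ut \<chi> 1)"
  by (simp add: U_def to_U_def quot_def FactRing_def Ut_one)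

text \<open>For a zero radical the coset product is well defined because products with 0 vanish; no
  ideal property of the radical has to be proved in general.\<close>

lemma U_mult:
  assumes "rad_ideal \<chi> = {\<zero>\<^bsub>Ut \<chi>\<^esub>}"
  shows "to_U \<chi> (to_Ut \<chi> f) \<otimes>\<^bsub>U \<chi>\<^esub> to_U \<chi> (to_Ut \<chi> g) = to_U \<chi> (to_Ut \<chi> (f * g))"
  unfolding U_def to_U_def
proof (rule Q.mult_quotient)
  fix x y assume "to_Ut \<chi> x \<in> rad_ideal \<chi>"
  then have x: "to_Ut \<chi> x = to_Ut \<chi> 0" using assms by (simp add: T.zero_eq)
  show "to_Ut \<chi> (x * y) \<in> rad_ideal \<chi>" "to_Ut \<chi> (y * x) \<in> rad_ideal \<chi>"
    using to_Ut_mult_cong[OF x refl[of "to_Ut \<chi> y"]] to_Ut_mult_cong[OF refl[of "to_Ut \<chi> y"] x]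
    by (simp_all add: assms T.zero_eq)
qed (simp_all add: Ut_mult algebra_simps)

lemma rad_ideal_trivial:
  assumes "\<And>a Y. neg_rad \<chi> a Y \<Longrightarrow> Y = \<zero>\<^bsub>Ut \<chi>\<^esub>"
  shows "rad_ideal \<chi> = {\<zero>\<^bsub>Ut \<chi>\<^esub>}"
proof -
  have I: "I_minus \<chi> \<subseteq> {\<zero>\<^bsub>Ut \<chi>\<^esub>}"
    unfolding I_minus_def using assms by (intro T.span_trivial) blast
  have zero_mult: "\<zero>\<^bsub>Ut \<chi>\<^esub> \<otimes>\<^bsub>Ut \<chi>\<^esub> z = \<zero>\<^bsub>Ut \<chi>\<^esub>" if "z \<in> carrier (Ut \<chi>)" for z
    using that by (auto simp: T.carrier_eq T.zero_eq Ut_mult)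
  have J: "J_minus \<chi> \<subseteq> {\<zero>\<^bsub>Ut \<chi>\<^esub>}"
    unfolding J_minus_def
  proof (rule T.span_trivial)
    show "{(y \<otimes>\<^bsub>Ut \<chi>\<^esub> z) \<otimes>\<^bsub>Ut \<chi>\<^esub> x |y z x. y \<in> I_minus \<chi> \<and> z \<in> Ut_zero \<chi> \<and> x \<in> Ut_plus \<chi>}
        \<subseteq> {\<zero>\<^bsub>Ut \<chi>\<^esub>}"
    proof
      fix W assume "W \<in> {(y \<otimes>\<^bsub>Ut \<chi>\<^esub> z) \<otimes>\<^bsub>Ut \<chi>\<^esub> x |y z x.
        y \<in> I_minus \<chi> \<and> z \<in> Ut_zero \<chi> \<and> x \<in> Ut_plus \<chi>}"
      then obtain y z x where W: "W = (y \<otimes>\<^bsub>Ut \<chi>\<^esub> z) \<otimes>\<^bsub>Ut \<chi>\<^esub> x"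
        "y \<in> I_minus \<chi>" "z \<in> Ut_zero \<chi>" "x \<in> Ut_plus \<chi>" by blast
      then have "y = \<zero>\<^bsub>Ut \<chi>\<^esub>" "z \<in> carrier (Ut \<chi>)" "x \<in> carrier (Ut \<chi>)"
        using I Ut_parts_carrier by blast+
      then show "W \<in> {\<zero>\<^bsub>Ut \<chi>\<^esub>}" by (simp add: W(1) zero_mult)
    qed
  qed
  show ?thesis
  proof
    show "rad_ideal \<chi> \<subseteq> {\<zero>\<^bsub>Ut \<chi>\<^esub>}"
    proof
      fix Z assume "Z \<in> rad_ideal \<chi>"
      then obtain X Y where "X \<in> J_minus \<chi>" "Y \<in> J_minus \<chi>" "Z = X \<oplus>\<^bsub>Ut \<chi>\<^esub> Omega \<chi> Y"
        by (auto simp: rad_ideal_iff)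
      with J have "Z = \<zero>\<^bsub>Ut \<chi>\<^esub> \<oplus>\<^bsub>Ut \<chi>\<^esub> Omega \<chi> \<zero>\<^bsub>Ut \<chi>\<^esub>" by blast
      then show "Z \<in> {\<zero>\<^bsub>Ut \<chi>\<^esub>}" unfolding Omega_zero by (simp add: T.zero_eq T.add_eq)
    qed
    show "{\<zero>\<^bsub>Ut \<chi>\<^esub>} \<subseteq> rad_ideal \<chi>" using rad_ideal_zero by (simp add: T.zero_eq)
  qed
qed

end

end

section \<open>The radical for a single index\<close>

context rank_one
begin

interpretation T: presented_space "Ut \<chi>" "to_Ut \<chi>" by (rule presented_space_Ut)
interpretation U: presented_space "U \<chi>" "\<lambda>f. to_U \<chi> (to_Ut \<chi> f)" by (rule presented_space_U[OF bihom])

lemma root_eqI: "Poly_Mapping.lookup a i1 = Poly_Mapping.lookup b i1 \<Longrightarrow> a = (b :: 'i root_lattice)"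
  using only by (intro poly_mapping_eqI) metis

lemma nonneg_iff: "a \<in> nonneg \<longleftrightarrow> 0 \<le> Poly_Mapping.lookup (a :: 'i root_lattice) i1"
  unfolding nonneg_def mem_Collect_eq
proof (intro iffI allI)
  fix i assume "0 \<le> Poly_Mapping.lookup a i1"
  then show "0 \<le> Poly_Mapping.lookup a i" by (subst only[of i])
qed blast

lemma lookup_alpha [simp]: "Poly_Mapping.lookup (\<alpha> i) i1 = 1"
  using only[of i] by (simp add: simple_root_def)

lemma word_degree_Fw: "word_degree (Fw n) = - Poly_Mapping.single i1 (int n)"
proof (rule root_eqI)
  show "Poly_Mapping.lookup (word_degree (Fw n)) i1 = Poly_Mapping.lookup (- Poly_Mapping.single i1 (int n)) i1"
    by (induction n) (simp_all add: word_degree_def Fw_def lookup_add lookup_minus)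
qed

lemma F_power_degree: "to_Ut \<chi> (scal c * F ^ n) \<in> Ut_degree \<chi> (- Poly_Mapping.single i1 (int n))"
  unfolding Ut_degree_def
  by (rule imageI) (auto simp: word_degree_Fw simp flip: single_Fw split: if_splits)

lemma commutator_E: "commutator (Ut \<chi>) (tE \<chi> i) (to_Ut \<chi> f) = to_Ut \<chi> (E * f - f * E)"
  using only[of i] by (simp add: commutator_def Ut_mult T.minus_eq)

text \<open>In [E, c F^n] = c F^(n-1) ([n] L - [n]' K), where [n]' is [n] at q^-1, both coefficients
  vanish at \<open>n = m\<close>, while for larger \<open>n\<close> the power F^(n-1) is already in
  the radical. The alternative \<open>c = 0\<close> puts the zero element in every degree, as the
  step at \<open>n = m\<close> requires.\<close>

lemma neg_rad_F_power:
  assumes "qnum m = 0" "m > 0" "n \<ge> m \<or> c = 0"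
  shows "neg_rad \<chi> (Poly_Mapping.single i1 (int n)) (to_Ut \<chi> (scal c * F ^ n))"
  using assms(3)
proof (induction n arbitrary: c)
  case 0
  then show ?case using assms(2) neg_rad.zero[of \<chi>] by (simp add: T.zero_eq)
next
  case (Suc n)
  let ?a = "Poly_Mapping.single i1 (int (Suc n)) :: 'i root_lattice"
  define x y where "x = c * qnum' (Suc n)" and "y = c * qnum (Suc n)"
  \<comment> \<open>The new exponent is \<open>Suc n\<close>, so \<open>m \<le> n\<close> can fail
    only if it equals \<open>m\<close>, where both q-numbers vanish, or if
    \<open>c = 0\<close>.\<close>
  have xy: "n \<ge> m \<or> (x = 0 \<and> y = 0)"
  proof (cases "Suc n = m")
    case True
    then show ?thesis using assms(1) by (simp add: x_def y_def qnum'_zero_iff)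
  qed (use Suc.prems in \<open>auto simp: x_def y_def\<close>)
  show ?case
  proof (rule neg_rad.step)
    show "?a \<in> nonneg" by (simp add: nonneg_iff)
    show "?a \<noteq> 0" by (metis lookup_single_eq lookup_zero of_nat_eq_0_iff nat.distinct(2))
    show "to_Ut \<chi> (scal c * F ^ Suc n) \<in> Ut_minus \<chi>"
      using nf_scal[of c "F ^ Suc n"] unfolding Ut_minus_eq nf_F_power by (metis rangeI)
    show "to_Ut \<chi> (scal c * F ^ Suc n) \<in> Ut_degree \<chi> (- ?a)" by (rule F_power_degree)
    show "\<forall>i. ?a - \<alpha> i \<in> nonneg \<longrightarrow> (\<exists>Y1 Y2. neg_rad \<chi> (?a - \<alpha> i) Y1 \<and> neg_rad \<chi> (?a - \<alpha> i) Y2 \<and>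
        commutator (Ut \<chi>) (tE \<chi> i) (to_Ut \<chi> (scal c * F ^ Suc n)) =
          (Y1 \<otimes>\<^bsub>Ut \<chi>\<^esub> tK \<chi> (\<alpha> i)) \<oplus>\<^bsub>Ut \<chi>\<^esub> (Y2 \<otimes>\<^bsub>Ut \<chi>\<^esub> tL \<chi> (\<alpha> i)))"
    proof (intro allI impI exI conjI)
      fix i
      have a: "?a - \<alpha> i = Poly_Mapping.single i1 (int n)"
        by (rule root_eqI) (simp add: lookup_minus)
      show "neg_rad \<chi> (?a - \<alpha> i) (to_Ut \<chi> (scal (- x) * F ^ n))"
        "neg_rad \<chi> (?a - \<alpha> i) (to_Ut \<chi> (scal y * F ^ n))"
        unfolding a using xy by (intro Suc.IH; auto)+
      have "E * (scal c * F ^ Suc n) - scal c * F ^ Suc n * E = scal c * (E * F ^ Suc n - F ^ Suc n * E)"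
        by (simp only: right_diff_distrib scal_left_commute mult.assoc)
      also have "to_Ut \<chi> \<dots> = to_Ut \<chi> (scal c *
          (F ^ Suc n * E + F ^ (Suc n - 1) * (scal (qnum (Suc n)) * L1 - scal (qnum' (Suc n)) * K1) - F ^ Suc n * E))"
        by (intro to_Ut_mult_cong to_Ut_diff_cong refl E_F_power)
      also have "scal c *
          (F ^ Suc n * E + F ^ (Suc n - 1) * (scal (qnum (Suc n)) * L1 - scal (qnum' (Suc n)) * K1) - F ^ Suc n * E)
        = scal (- x) * F ^ n * K1 + scal y * F ^ n * L1"
        by (simp add: right_diff_distrib scal_left_commute[of "F ^ n"] scal_scal x_def y_def scal_minus mult.assoc
            del: power_Suc)
      finally show "commutator (Ut \<chi>) (tE \<chi> i) (to_Ut \<chi> (scal c * F ^ Suc n)) =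
          (to_Ut \<chi> (scal (- x) * F ^ n) \<otimes>\<^bsub>Ut \<chi>\<^esub> tK \<chi> (\<alpha> i)) \<oplus>\<^bsub>Ut \<chi>\<^esub>
          (to_Ut \<chi> (scal y * F ^ n) \<otimes>\<^bsub>Ut \<chi>\<^esub> tL \<chi> (\<alpha> i))"
        using only[of i] by (simp add: commutator_E Ut_mult T.add_eq)
    qed
  qed
qed

text \<open>Composing with the projection \<open>nf\<close> presents the subalgebra by the whole
  free algebra, so that the general facts on spans apply to it.\<close>

lemma presented_space_U_minus: "presented_space (U_minus \<chi>) (\<lambda>f. to_U \<chi> (to_Ut \<chi> (nf f)))"
proof
  show "carrier (U_minus \<chi>) = range (\<lambda>f. to_U \<chi> (to_Ut \<chi> (nf f)))"
    by (simp add: U_minus_def Ut_minus_eq image_image)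
  have "U_minus \<chi> = (U \<chi>)\<lparr>carrier := carrier (U_minus \<chi>)\<rparr>" by (simp add: U_minus_def)
  then have ops: "add (U_minus \<chi>) = add (U \<chi>)" "zero (U_minus \<chi>) = zero (U \<chi>)"
    "smult (U_minus \<chi>) = smult (U \<chi>)" by (simp_all add: U_minus_def)
  show "\<zero>\<^bsub>U_minus \<chi>\<^esub> = to_U \<chi> (to_Ut \<chi> (nf 0))"
    by (simp add: ops U.zero_eq)
  show "to_U \<chi> (to_Ut \<chi> (nf x)) \<oplus>\<^bsub>U_minus \<chi>\<^esub> to_U \<chi> (to_Ut \<chi> (nf y)) = to_U \<chi> (to_Ut \<chi> (nf (x + y)))" for x y
    by (simp add: ops U.add_eq nf_add)
  show "c \<odot>\<^bsub>U_minus \<chi>\<^esub> to_U \<chi> (to_Ut \<chi> (nf x)) = to_U \<chi> (to_Ut \<chi> (nf (scal c * x)))" for c x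
    by (simp add: ops U.smult_eq nf_scal)
qed

lemma qnum_nonzero:
  assumes "\<not> finite_dim (U_minus \<chi>)" "m > 0" shows "qnum m \<noteq> 0"
proof
  assume m: "qnum m = 0"
  let ?\<pi> = "\<lambda>f. to_U \<chi> (to_Ut \<chi> (nf f))"
  interpret M: presented_space "U_minus \<chi>" ?\<pi> by (rule presented_space_U_minus)
  let ?A = "(\<lambda>n. ?\<pi> (F ^ n)) ` {..<m}"
  have A: "?A \<subseteq> carrier (U_minus \<chi>)" using M.mem_carrier by blast
  have zero: "?\<pi> (F ^ n) = \<zero>\<^bsub>U_minus \<chi>\<^esub>" if "n \<ge> m" for n
  proof -
    have "to_Ut \<chi> (F ^ n) \<in> I_minus \<chi>"
      unfolding I_minus_def
      using that neg_rad_F_power[OF m assms(2), of n 1]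
      by (intro T.span_incl) (auto simp: neg_rad_carrier nonneg_iff intro!: bexI[of _ "Poly_Mapping.single i1 (int n)"])
    then have "to_Ut \<chi> (F ^ n) \<in> rad_ideal \<chi>"
      using I_minus_sub_J_minus J_minus_sub_rad[OF bihom] by blast
    then show ?thesis by (simp add: to_U_eq_zero_iff[OF bihom, symmetric] M.zero_eq U.zero_eq)
  qed
  have mem: "?\<pi> (F ^ n) \<in> kspan (U_minus \<chi>) ?A" for n
  proof (cases "n < m")
    case True
    then show ?thesis by (intro M.span_incl[OF A]) auto
  next
    case False
    then show ?thesis using zero[of n] M.span_zero[OF A] by simp
  qed
  have "?\<pi> (nf f) \<in> kspan (U_minus \<chi>) ?A" for f
  proof (induction f rule: nf_induct)
    case (power n c)
    show ?case by (rule M.span_smult[OF A mem])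
  next
    case (add f g)
    then show ?case by (rule M.span_add[OF A])
  qed
  then have "kspan (U_minus \<chi>) ?A = carrier (U_minus \<chi>)"
    using M.span_sub[OF A] by (auto simp: M.carrier_eq nf_nf)
  with assms(1) A show False unfolding M.finite_dim_iff by blast
qed

text \<open>Homogeneity forces Y = c F^n. The induction hypothesis turns the condition on Y into
  [E, Y] = 0, and applied to \<open>e0\<close> this gives c \<open>cc n\<close> = 0 for every
  weight, enough to force c = 0.\<close>

lemma neg_rad_trivial:
  assumes nz: "\<And>n. n > 0 \<Longrightarrow> qnum n \<noteq> 0"
  shows "neg_rad \<chi> a Y \<Longrightarrow> Y = \<zero>\<^bsub>Ut \<chi>\<^esub>"
proof (induction rule: neg_rad.induct)
  case zero
  show ?case ..
next
  case (step a Y)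
  define n where "n = nat (Poly_Mapping.lookup a i1)"
  have "Poly_Mapping.lookup a i1 \<noteq> 0" using step.hyps(2) root_eqI[of a 0] by auto
  with step.hyps(1) have n: "Poly_Mapping.lookup a i1 = int n" "n > 0"
    by (auto simp: n_def nonneg_iff)
  obtain f where f: "Y = to_Ut \<chi> (nf f)" using step.hyps(3) by (auto simp: Ut_minus_eq)
  obtain g where g: "Y = to_Ut \<chi> g" "\<forall>w\<in>Poly_Mapping.keys g. word_degree w = - a"
    using step.hyps(4) by (auto simp: Ut_degree_def)
  have "a - \<alpha> i1 \<in> nonneg" using n by (simp add: nonneg_iff lookup_minus)
  with step.IH have "commutator (Ut \<chi>) (tE \<chi> i1) Y =
      (\<zero>\<^bsub>Ut \<chi>\<^esub> \<otimes>\<^bsub>Ut \<chi>\<^esub> tK \<chi> (\<alpha> i1)) \<oplus>\<^bsub>Ut \<chi>\<^esub> (\<zero>\<^bsub>Ut \<chi>\<^esub> \<otimes>\<^bsub>Ut \<chi>\<^esub> tL \<chi> (\<alpha> i1))"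
    by metis
  then have comm: "to_Ut \<chi> (E * nf f - nf f * E) = to_Ut \<chi> 0"
    by (simp add: f commutator_E T.zero_eq Ut_mult T.add_eq)
  define c where "c = Poly_Mapping.lookup (nf f) (Fw n)"
  have key: "nf f = scal c * F ^ n \<and> c * (\<mu> (\<alpha> i1) * qnum n - \<kappa> (\<alpha> i1) * qnum' n) = 0"
    if "rank_one_weight \<chi> i1 \<kappa> \<mu>" for \<kappa> \<mu>
  proof -
    interpret W: rank_one_weight \<chi> i1 \<kappa> \<mu> by (rule that)
    have c: "W.act (nf f) W.e0 m = (if m = n then c else 0)" for m
    proof (cases "m = n")
      case False
      have "W.act g W.e0 m = 0"
        using W.act_degree[OF g(2), of m] False n by auto
      then show ?thesis using W.act_to_Ut[of "nf f" g W.e0 m] f g False by simp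
    qed (simp add: W.act_nf c_def)
    have "W.act (nf (f - scal c * F ^ n)) W.e0 m = 0" for m
      by (simp add: nf_diff nf_scal W.act_diff W.act_scal_mult c W.act_F_power)
    from W.nf_eq_0[OF this] have eq: "nf f = scal c * F ^ n" by (simp add: nf_diff nf_scal)
    have E: "W.act (h * E) W.e0 m = 0" for h m
    proof -
      have "W.act E W.e0 = (\<lambda>m. 0)" by (rule ext) (simp add: W.act_gen W.e0_def)
      then show ?thesis by (simp add: W.act_mult W.act_zero_right)
    qed
    \<comment> \<open>Coordinate \<open>n - 1\<close> is where E F^n \<open>e0\<close> can be
      nonzero; the other product vanishes since E kills \<open>e0\<close>.\<close>
    have "W.act (E * nf f) W.e0 (n - 1) = W.act (nf f * E) W.e0 (n - 1)"
      using W.act_to_Ut[OF comm, of W.e0 "n - 1"] by (simp add: W.act_diff)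
    then have "W.cc n * c = 0" using n(2) by (simp add: E W.act_gen_mult c)
    with eq show ?thesis by (simp add: W.cc_eq mult.commute)
  qed
  have w1: "rank_one_weight \<chi> i1 (\<lambda>_. 1) (\<lambda>_. 1)"
    by unfold_locales simp_all
  \<comment> \<open>The sign character of the lattice: K takes the value -1 on the simple root, L
    stays 1. Integer powers are needed because lattice coordinates may be negative.\<close>
  have w2: "rank_one_weight \<chi> i1 (\<lambda>a. (- 1) powi Poly_Mapping.lookup a i1) (\<lambda>_. 1)"
    by unfold_locales (simp_all add: lookup_add power_int_add)
  have z: "c * (qnum n - qnum' n) = 0" "c * (qnum n + qnum' n) = 0"
    using key[OF w1] key[OF w2] by simp_all
  \<comment> \<open>Adding the two equations eliminates [n] at q^-1; characteristic 0 permits the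
    division by 2.\<close>
  have "2 * (c * qnum n) = c * (qnum n - qnum' n) + c * (qnum n + qnum' n)"
    by (simp add: algebra_simps)
  then have "2 * (c * qnum n) = 0" unfolding z by simp
  with nz[OF n(2)] have "c = 0" by simp
  with key[OF w1] show ?case by (simp add: f T.zero_eq)
qed

lemma rad_ideal_eq:
  assumes "\<not> finite_dim (U_minus \<chi>)" shows "rad_ideal \<chi> = {\<zero>\<^bsub>Ut \<chi>\<^esub>}"
  by (rule rad_ideal_trivial[OF bihom], rule neg_rad_trivial) (use qnum_nonzero[OF assms] in auto)

end

section \<open>The Verma module in rank one\<close>

lemma poly_mapping_sum_singles: "f = (\<Sum>w\<in>Poly_Mapping.keys f. Poly_Mapping.single w (Poly_Mapping.lookup f w))"
proof (rule poly_mapping_eqI)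
  fix k
  have "(\<Sum>w\<in>Poly_Mapping.keys f. Poly_Mapping.lookup f w when w = k) = Poly_Mapping.lookup f k"
    by (simp add: when_def in_keys_iff)
  then show "Poly_Mapping.lookup f k =
      Poly_Mapping.lookup (\<Sum>w\<in>Poly_Mapping.keys f. Poly_Mapping.single w (Poly_Mapping.lookup f w)) k"
    by (simp add: lookup_sum lookup_single)
qed

locale rank_one_verma = rank_one \<chi> i1
  for \<chi> :: "('i, 'k::field_char_0) bichar" and i1 :: 'i +
  fixes \<Lambda> :: "('i, 'k) weight"
  assumes infinite_dim: "\<not> finite_dim (U_minus \<chi>)" and character: "\<Lambda> \<in> Ch \<chi>"
begin

abbreviation pu :: "('i, 'k) pre \<Rightarrow> ('i, 'k) pre set set" where
  "pu f \<equiv> to_U \<chi> (to_Ut \<chi> f)"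

sublocale T: presented_space "Ut \<chi>" "to_Ut \<chi>" by (rule presented_space_Ut)
sublocale U: presented_space "U \<chi>" pu by (rule presented_space_U[OF bihom])

lemma pu_mult: "pu f \<otimes>\<^bsub>U \<chi>\<^esub> pu g = pu (f * g)"
  by (rule U_mult[OF bihom rad_ideal_eq[OF infinite_dim]])

lemma pu_eq_iff: "pu f = pu g \<longleftrightarrow> to_Ut \<chi> f = to_Ut \<chi> g"
  using U.eq_iff[of f g] T.eq_iff[of f g] to_U_eq_zero_iff[OF bihom, of "f - g"]
    rad_ideal_eq[OF infinite_dim] by simp

definition zero_part :: "('i, 'k) pre set" where
  "zero_part = {f. to_Ut \<chi> f \<in> Ut_zero \<chi>}"

lemma
  shows zero_part_add: "f \<in> zero_part \<Longrightarrow> g \<in> zero_part \<Longrightarrow> f + g \<in> zero_part"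
    and zero_part_mult: "f \<in> zero_part \<Longrightarrow> g \<in> zero_part \<Longrightarrow> f * g \<in> zero_part"
    and zero_part_scal: "f \<in> zero_part \<Longrightarrow> scal c * f \<in> zero_part"
    and zero_part_1: "1 \<in> zero_part"
    and zero_part_K: "fK a \<in> zero_part" and zero_part_L: "fL a \<in> zero_part"
  unfolding zero_part_def Ut_zero_def
  using subalg_gen.add[of "to_Ut \<chi> f" "Ut \<chi>" _ "to_Ut \<chi> g"] subalg_gen.mult[of "to_Ut \<chi> f" "Ut \<chi>" _ "to_Ut \<chi> g"]
    subalg_gen.smult[of "to_Ut \<chi> f" "Ut \<chi>"] subalg_gen.one[of "Ut \<chi>"]
  by (auto simp: T.add_eq T.smult_eq Ut_mult Ut_one intro: subalg_gen.incl)

definition lam :: "('i, 'k) pre \<Rightarrow> 'k" where "lam f = \<Lambda> (pu f)"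

lemma pu_zero_part: "f \<in> zero_part \<Longrightarrow> pu f \<in> carrier (U_zero \<chi>)"
  by (auto simp: zero_part_def U_zero_def)

lemma
  shows lam_add: "f \<in> zero_part \<Longrightarrow> g \<in> zero_part \<Longrightarrow> lam (f + g) = lam f + lam g"
    and lam_mult: "f \<in> zero_part \<Longrightarrow> g \<in> zero_part \<Longrightarrow> lam (f * g) = lam f * lam g"
    and lam_scal: "f \<in> zero_part \<Longrightarrow> lam (scal c * f) = c * lam f"
    and lam_1: "lam 1 = 1"
proof -
  have ops: "add (U_zero \<chi>) = add (U \<chi>)" "mult (U_zero \<chi>) = mult (U \<chi>)"
    "smult (U_zero \<chi>) = smult (U \<chi>)" "one (U_zero \<chi>) = one (U \<chi>)" by (simp_all add: U_zero_def)
  note hom = character[unfolded Ch_def alg_hom_def Ring.ring_hom_def scalar_alg_def, simplified]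
  show "lam (f + g) = lam f + lam g" if "f \<in> zero_part" "g \<in> zero_part"
    using hom pu_zero_part[OF that(1)] pu_zero_part[OF that(2)]
    by (simp add: lam_def ops flip: U.add_eq)
  show "lam (f * g) = lam f * lam g" if "f \<in> zero_part" "g \<in> zero_part"
    using hom pu_zero_part[OF that(1)] pu_zero_part[OF that(2)]
    by (simp add: lam_def ops flip: pu_mult)
  show "lam (scal c * f) = c * lam f" if "f \<in> zero_part"
    using hom pu_zero_part[OF that] by (simp add: lam_def ops flip: U.smult_eq)
  show "lam 1 = 1" using hom by (simp add: lam_def ops U_one[OF bihom])
qed

lemma lam_cong: "to_Ut \<chi> f = to_Ut \<chi> g \<Longrightarrow> lam f = lam g"
  by (simp add: lam_def)

text \<open>From here on \<open>act\<close> and \<open>cc\<close> belong to the weight \<Lambda>, in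
  contrast to the auxiliary weights used for the radical.\<close>

sublocale rank_one_weight \<chi> i1 "\<lambda>a. lam (fK a)" "\<lambda>a. lam (fL a)"
proof
  show "lam (fK 0) = 1" "lam (fL 0) = 1"
    using lam_cong[OF rel_K0] lam_cong[OF rel_L0] lam_1 by simp_all
  show "lam (fK (a + b)) = lam (fK a) * lam (fK b)" "lam (fL (a + b)) = lam (fL a) * lam (fL b)" for a b
    using lam_cong[OF rel_KK[of \<chi> a b]] lam_cong[OF rel_LL[of \<chi> a b]]
    by (simp_all add: lam_mult zero_part_K zero_part_L)
qed

lemma act_smult_right: "act f (\<lambda>m. c * v m) n = c * act f v n"
proof -
  have "act (scal c) v = (\<lambda>m. c * v m)" by (rule ext) (simp add: act_scal)
  then have "act f (\<lambda>m. c * v m) n = act (f * scal c) v n" by (simp add: act_mult)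
  then show ?thesis by (simp add: scal_commute act_scal_mult)
qed

text \<open>\<open>e0\<close> is an eigenvector of every K and L, and both sides are multiplicative
  along the generation of U^0. The induction is over classes with \<open>f\<close> an arbitrary
  representative, and carries membership in \<open>zero_part\<close> along because
  \<open>lam\<close> is multiplicative only there.\<close>

lemma act_zero_part:
  assumes "f \<in> zero_part" shows "act f e0 n = lam f * e0 n"
proof -
  have rep: "\<exists>x. X = to_Ut \<chi> x" if "X \<in> subalg_gen (Ut \<chi>) (range (tK \<chi>) \<union> range (tL \<chi>))" for X
    using that Ut_parts_carrier(1)[of \<chi>] unfolding Ut_zero_def T.carrier_eq by blast
  have "f \<in> zero_part \<and> act f e0 = (\<lambda>n. lam f * e0 n)"
    if "X \<in> subalg_gen (Ut \<chi>) (range (tK \<chi>) \<union> range (tL \<chi>))" "X = to_Ut \<chi> f" for X f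
    using that
  proof (induction arbitrary: f rule: subalg_gen.induct)
    case one
    then have f: "to_Ut \<chi> f = to_Ut \<chi> 1" by (simp add: Ut_one)
    with act_to_Ut[OF f] lam_cong[OF f] zero_part_1 show ?case
      by (auto simp: lam_1 zero_part_def)
  next
    case (incl X)
    then consider a where "to_Ut \<chi> f = tK \<chi> a" | a where "to_Ut \<chi> f = tL \<chi> a" by auto
    then show ?case
    proof cases
      case 1
      from act_to_Ut[OF 1] lam_cong[OF 1] 1 zero_part_K[of a] show ?thesis
        by (auto simp: act_gen zero_part_def e0_def)
    next
      case 2
      from act_to_Ut[OF 2] lam_cong[OF 2] 2 zero_part_L[of a] show ?thesis
        by (auto simp: act_gen zero_part_def e0_def)
    qed
  next
    case (add X Y)
    from rep[OF this(1)] rep[OF this(2)] obtain x y where xy: "X = to_Ut \<chi> x" "Y = to_Ut \<chi> y" by blast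
    with add have f: "to_Ut \<chi> f = to_Ut \<chi> (x + y)" by (simp add: T.add_eq)
    from add.IH(1)[OF xy(1)] add.IH(2)[OF xy(2)] act_to_Ut[OF f] lam_cong[OF f] zero_part_add[of x y] f
    show ?case by (auto simp: act_add lam_add distrib_right zero_part_def)
  next
    case (mult X Y)
    from rep[OF this(1)] rep[OF this(2)] obtain x y where xy: "X = to_Ut \<chi> x" "Y = to_Ut \<chi> y" by blast
    with mult have f: "to_Ut \<chi> f = to_Ut \<chi> (x * y)" by (simp add: Ut_mult)
    from mult.IH(1)[OF xy(1)] mult.IH(2)[OF xy(2)] act_to_Ut[OF f] lam_cong[OF f] zero_part_mult[of x y] f
    show ?case by (auto simp: act_mult act_smult_right lam_mult zero_part_def)
  next
    case (smult X c)
    from rep[OF this(1)] obtain x where x: "X = to_Ut \<chi> x" by blast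
    with smult have f: "to_Ut \<chi> f = to_Ut \<chi> (scal c * x)" by (simp add: T.smult_eq)
    from smult.IH[OF x] act_to_Ut[OF f] lam_cong[OF f] zero_part_scal[of x c] f
    show ?case by (auto simp: act_scal_mult lam_scal zero_part_def)
  qed
  from this[of "to_Ut \<chi> f" f] assms show ?thesis by (simp add: zero_part_def Ut_zero_def)
qed

section \<open>The Verma ideal inside an annihilator\<close>

definition verma_rels :: "('i, 'k) pre set set set" where
  "verma_rels = range (uE \<chi>) \<union> {z \<ominus>\<^bsub>U \<chi>\<^esub> (\<Lambda> z \<odot>\<^bsub>U \<chi>\<^esub> \<one>\<^bsub>U \<chi>\<^esub>) |z. z \<in> carrier (U_zero \<chi>)}"

lemma verma_ideal_eq_Inter:
  "verma_ideal \<chi> \<Lambda> = \<Inter>{N. left_submodule (U \<chi>) (regular_module (U \<chi>)) N \<and> verma_rels \<subseteq> N}"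
  by (simp add: verma_ideal_def left_submodule_gen_def verma_rels_def)

lemma verma_rel_E: "pu E \<in> verma_rels"
  by (auto simp: verma_rels_def)

lemma verma_rel_zero_part: "f \<in> zero_part \<Longrightarrow> pu (f - scal (lam f)) \<in> verma_rels"
  unfolding verma_rels_def using pu_zero_part[of f]
  by (auto simp: U_one[OF bihom] U.smult_eq U.minus_eq lam_def intro!: exI[of _ "pu f"])

definition annihilator :: "('i, 'k) pre set set set" where
  "annihilator = pu ` {f. \<forall>n. act f e0 n = 0}"

lemma mem_annihilator: "pu f \<in> annihilator \<longleftrightarrow> (\<forall>n. act f e0 n = 0)"
proof
  assume "pu f \<in> annihilator"
  then obtain g where "to_Ut \<chi> f = to_Ut \<chi> g" "\<forall>n. act g e0 n = 0"
    unfolding annihilator_def by (auto simp: pu_eq_iff)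
  then show "\<forall>n. act f e0 n = 0" using act_to_Ut[of f g] by simp
qed (simp add: annihilator_def)

lemma left_submodule_regularI:
  assumes "\<And>X. X \<in> N \<Longrightarrow> X \<in> carrier (U \<chi>)" "pu 0 \<in> N"
    and "\<And>f g. pu f \<in> N \<Longrightarrow> pu g \<in> N \<Longrightarrow> pu (f + g) \<in> N" "\<And>f g. pu f \<in> N \<Longrightarrow> pu (g * f) \<in> N"
  shows "left_submodule (U \<chi>) (regular_module (U \<chi>)) N"
  unfolding left_submodule_def regular_module_def
proof (simp, intro conjI ballI subsetI)
  show "\<zero>\<^bsub>U \<chi>\<^esub> \<in> N" using assms(2) by (simp add: U.zero_eq)
  fix X assume X: "X \<in> N"
  then show "X \<in> carrier (U \<chi>)" by (rule assms(1))
  then obtain f where f: "X = pu f" by (rule U.carrier_obtain)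
  show "X \<oplus>\<^bsub>U \<chi>\<^esub> Y \<in> N" if "Y \<in> N" for Y
  proof -
    from assms(1)[OF that] obtain g where "Y = pu g" by (rule U.carrier_obtain)
    with X f that assms(3) show ?thesis by (simp add: U.add_eq)
  qed
  show "Y \<otimes>\<^bsub>U \<chi>\<^esub> X \<in> N" if "Y \<in> carrier (U \<chi>)" for Y
  proof -
    from that obtain g where "Y = pu g" by (rule U.carrier_obtain)
    with X f assms(4) show ?thesis by (simp add: pu_mult)
  qed
qed

lemma left_submodule_annihilator:
  "left_submodule (U \<chi>) (regular_module (U \<chi>)) annihilator"
proof (rule left_submodule_regularI)
  fix f g assume "pu f \<in> annihilator"
  then have "act f e0 = (\<lambda>n. 0)" by (simp add: mem_annihilator fun_eq_iff)
  then show "pu (g * f) \<in> annihilator" by (simp add: mem_annihilator act_mult act_zero_right)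
next
  fix X assume "X \<in> annihilator"
  then show "X \<in> carrier (U \<chi>)" by (auto simp: annihilator_def)
qed (simp_all add: mem_annihilator act_add)

lemma verma_rels_annihilator: "verma_rels \<subseteq> annihilator"
proof
  fix X assume "X \<in> verma_rels"
  then consider i where "X = uE \<chi> i"
    | z where "X = z \<ominus>\<^bsub>U \<chi>\<^esub> (\<Lambda> z \<odot>\<^bsub>U \<chi>\<^esub> \<one>\<^bsub>U \<chi>\<^esub>)" "z \<in> carrier (U_zero \<chi>)"
    by (auto simp: verma_rels_def)
  then show "X \<in> annihilator"
  proof cases
    case 1
    then show ?thesis by (simp add: mem_annihilator act_gen e0_def)
  next
    case 2
    then obtain Y where Y: "Y \<in> Ut_zero \<chi>" "z = to_U \<chi> Y" by (auto simp: U_zero_def)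
    then obtain f where f: "f \<in> zero_part" "z = pu f"
      using Ut_parts_carrier(1) by (metis T.carrier_obtain mem_Collect_eq subsetD zero_part_def)
    then have "X = pu (f - scal (lam f))"
      by (simp add: 2 U_one[OF bihom] U.smult_eq U.minus_eq lam_def)
    then show ?thesis by (simp add: mem_annihilator act_diff act_scal act_zero_part f)
  qed
qed

lemma verma_ideal_sub: "verma_ideal \<chi> \<Lambda> \<subseteq> annihilator"
  unfolding verma_ideal_eq_Inter
  by (rule Inter_lower) (simp add: left_submodule_annihilator verma_rels_annihilator)

lemma left_submodule_verma_ideal:
  "left_submodule (U \<chi>) (regular_module (U \<chi>)) (verma_ideal \<chi> \<Lambda>)"
proof (rule left_submodule_regularI)
  note sub = left_submodule_def regular_module_def
  \<comment> \<open>An intersection of submodules lies in the carrier because the family is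
    nonempty; \<open>annihilator\<close> is a member.\<close>
  show "X \<in> carrier (U \<chi>)" if "X \<in> verma_ideal \<chi> \<Lambda>" for X
    using subsetD[OF verma_ideal_sub that] by (auto simp: annihilator_def)
  show "pu 0 \<in> verma_ideal \<chi> \<Lambda>"
    by (simp add: verma_ideal_eq_Inter sub U.zero_eq)
  show "pu (f + g) \<in> verma_ideal \<chi> \<Lambda>" if "pu f \<in> verma_ideal \<chi> \<Lambda>" "pu g \<in> verma_ideal \<chi> \<Lambda>" for f g
    using that by (simp add: verma_ideal_eq_Inter sub flip: U.add_eq)
  show "pu (g * f) \<in> verma_ideal \<chi> \<Lambda>" if "pu f \<in> verma_ideal \<chi> \<Lambda>" for f g
    using that by (simp add: verma_ideal_eq_Inter sub flip: pu_mult)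
qed

lemma verma_rels_sub: "verma_rels \<subseteq> verma_ideal \<chi> \<Lambda>"
  unfolding verma_ideal_eq_Inter by blast

lemma
  shows verma_ideal_0: "pu 0 \<in> verma_ideal \<chi> \<Lambda>"
    and verma_ideal_add: "pu f \<in> verma_ideal \<chi> \<Lambda> \<Longrightarrow> pu g \<in> verma_ideal \<chi> \<Lambda> \<Longrightarrow> pu (f + g) \<in> verma_ideal \<chi> \<Lambda>"
    and verma_ideal_mult: "pu f \<in> verma_ideal \<chi> \<Lambda> \<Longrightarrow> pu (h * f) \<in> verma_ideal \<chi> \<Lambda>"
proof -
  note sub = left_submodule_verma_ideal[unfolded left_submodule_def regular_module_def, simplified]
  show "pu 0 \<in> verma_ideal \<chi> \<Lambda>" using sub by (simp add: U.zero_eq)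
  show "pu f \<in> verma_ideal \<chi> \<Lambda> \<Longrightarrow> pu g \<in> verma_ideal \<chi> \<Lambda> \<Longrightarrow> pu (f + g) \<in> verma_ideal \<chi> \<Lambda>"
    using sub by (simp flip: U.add_eq)
  show "pu f \<in> verma_ideal \<chi> \<Lambda> \<Longrightarrow> pu (h * f) \<in> verma_ideal \<chi> \<Lambda>"
    using sub by (simp flip: pu_mult)
qed

section \<open>Spanning by the powers of F modulo the Verma ideal\<close>

definition vcong :: "('i, 'k) pre \<Rightarrow> ('i, 'k) pre \<Rightarrow> bool" where
  "vcong f g \<longleftrightarrow> pu (f - g) \<in> verma_ideal \<chi> \<Lambda>"

lemma vcong_trans: "vcong f g \<Longrightarrow> vcong g h \<Longrightarrow> vcong f h"
  unfolding vcong_def using verma_ideal_add[of "f - g" "g - h"] by simp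

lemma vcong_add: "vcong f g \<Longrightarrow> vcong f' g' \<Longrightarrow> vcong (f + f') (g + g')"
  unfolding vcong_def using verma_ideal_add[of "f - g" "f' - g'"] by (simp add: algebra_simps)

lemma vcong_mult: "vcong f g \<Longrightarrow> vcong (h * f) (h * g)"
  unfolding vcong_def using verma_ideal_mult[of "f - g" h] by (simp add: algebra_simps)

lemma vcong_to_Ut: "to_Ut \<chi> f = to_Ut \<chi> g \<Longrightarrow> vcong f g"
  unfolding vcong_def using verma_ideal_0 U.minus_eq[of f g] U.minus_eq[of g g] by simp

lemma vcong_zero_part: "f \<in> zero_part \<Longrightarrow> vcong f (scal (lam f))"
  unfolding vcong_def using verma_rel_zero_part verma_rels_sub by blast

lemma vcong_act: "vcong f g \<Longrightarrow> act f e0 n = act g e0 n"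
  unfolding vcong_def using verma_ideal_sub by (auto simp: mem_annihilator act_diff dest!: subsetD)

lemma vcong_E: "vcong E 0"
  unfolding vcong_def using verma_rel_E verma_rels_sub by auto

text \<open>Congruence modulo a left ideal is stable under left multiplication, so \<open>z\<close>
  is moved to the far right before it is replaced by its eigenvalue.\<close>

lemma vcong_zero_part_F_power:
  assumes "qcomm \<chi> c z F" "z \<in> zero_part"
  shows "vcong (z * F ^ n) (scal (c ^ n * lam z) * F ^ n)"
proof -
  have "vcong (z * F ^ n) (scal (c ^ n) * F ^ n * z)"
    using vcong_to_Ut[OF qcomm_power[OF assms(1), unfolded qcomm_def]] by (simp add: mult.assoc)
  moreover have "vcong (scal (c ^ n) * F ^ n * z) (scal (c ^ n) * F ^ n * scal (lam z))"
    by (rule vcong_mult[OF vcong_zero_part[OF assms(2)]])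
  moreover have "scal (c ^ n) * F ^ n * scal (lam z) = scal (c ^ n * lam z) * F ^ n"
    by (simp add: mult.assoc scal_commute[of "F ^ n"] scal_scal)
  ultimately show ?thesis by (auto intro: vcong_trans)
qed

lemma vcong_E_F_power: "vcong (E * F ^ n) (scal (cc n) * F ^ (n - 1))"
proof -
  have K: "vcong K1 (scal (lam K1))" and L: "vcong L1 (scal (lam L1))"
    by (simp_all add: vcong_zero_part zero_part_K zero_part_L)
  have "vcong (scal (qnum n) * L1 + scal (- qnum' n) * K1)
      (scal (qnum n) * scal (lam L1) + scal (- qnum' n) * scal (lam K1))"
    by (intro vcong_add vcong_mult K L)
  then have "vcong (scal (qnum n) * L1 - scal (qnum' n) * K1) (scal (cc n))"
    by (simp add: scal_minus cc_eq mult_single single_diff mult.commute)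
  then have "vcong (F ^ n * E + F ^ (n - 1) * (scal (qnum n) * L1 - scal (qnum' n) * K1))
      (F ^ n * 0 + F ^ (n - 1) * scal (cc n))"
    by (intro vcong_add vcong_mult vcong_E)
  from vcong_trans[OF vcong_to_Ut[OF E_F_power] this] show ?thesis by (simp add: scal_commute)
qed

lemma vcong_gen_F_power: "\<exists>d m. vcong (free_gen h * F ^ n) (scal d * F ^ m)"
proof (cases h)
  case (GK a)
  then show ?thesis using vcong_zero_part_F_power[OF rel_KF zero_part_K] by blast
next
  case (GL a)
  then show ?thesis using vcong_zero_part_F_power[OF rel_LF zero_part_L] by blast
next
  case (GE i)
  then show ?thesis using vcong_E_F_power only[of i] by blast
next
  case (GF i)
  then have "vcong (free_gen h * F ^ n) (scal 1 * F ^ Suc n)"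
    using vcong_to_Ut[OF refl, of "F ^ Suc n"] only[of i] by simp
  then show ?thesis by blast
qed

text \<open>By \<open>vcong_gen_F_power\<close>, left multiplication by any generator keeps
  multiples of powers of F of that form, so induction on letters shows that the F^n v span.\<close>

lemma vcong_nf: "\<exists>g. vcong f (nf g)"
proof (induction f rule: free_alg_gen_induct)
  case (scal c)
  have "nf (scal c) = scal c" using nf_scal[of c "F ^ 0"] nf_F_power[of 0] by simp
  then show ?case using vcong_to_Ut[OF refl, of "scal c"] by (intro exI[of _ "scal c"]) simp
next
  case (add f h)
  then show ?case using vcong_add by (metis nf_add)
next
  case (gen h f)
  then obtain g where g: "vcong f (nf g)" by blast
  have "\<exists>g'. vcong (free_gen h * nf g) (nf g')"
  proof (induction g rule: nf_induct)
    case (power n c)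
    obtain d m where dm: "vcong (free_gen h * F ^ n) (scal d * F ^ m)" using vcong_gen_F_power by blast
    have "free_gen h * (scal c * F ^ n) = scal c * (free_gen h * F ^ n)" by (rule scal_left_commute)
    moreover have "scal c * (scal d * F ^ m) = nf (scal (c * d) * F ^ m)"
      by (simp add: scal_scal nf_scal)
    ultimately show ?case using vcong_mult[OF dm, of "scal c"] by auto
  next
    case (add f g)
    then show ?case using vcong_add by (metis nf_add distrib_left)
  qed
  with vcong_trans[OF vcong_mult[OF g]] show ?case by blast
qed

text \<open>Spanning meets independence: modulo the ideal \<open>f\<close> is a polynomial in F, and
  such a polynomial acting as 0 on \<open>e0\<close> is 0. Hence the class of \<open>f\<close> in
  the Verma module is determined by the sequence \<open>act f e0\<close>.\<close>

lemma verma_ideal_iff: "pu f \<in> verma_ideal \<chi> \<Lambda> \<longleftrightarrow> (\<forall>n. act f e0 n = 0)"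
proof
  assume "pu f \<in> verma_ideal \<chi> \<Lambda>"
  then show "\<forall>n. act f e0 n = 0" using verma_ideal_sub mem_annihilator by blast
next
  assume z: "\<forall>n. act f e0 n = 0"
  obtain g where g: "vcong f (nf g)" using vcong_nf by blast
  with z vcong_act have "nf g = 0" by (intro nf_eq_0) metis
  with g show "pu f \<in> verma_ideal \<chi> \<Lambda>" by (simp add: vcong_def)
qed

section \<open>The Verma module in coordinates\<close>

definition pv :: "('i, 'k) pre \<Rightarrow> ('i, 'k) pre set set set" where
  "pv f = verma_ideal \<chi> \<Lambda> +>\<^bsub>regular_module (U \<chi>)\<^esub> pu f"

lemma presented_quot_verma: "presented_quot (regular_module (U \<chi>)) pu (verma_ideal \<chi> \<Lambda>)"
proof
  show "verma_ideal \<chi> \<Lambda> \<subseteq> carrier (regular_module (U \<chi>))"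
    using left_submodule_verma_ideal by (simp add: left_submodule_def)
qed (auto simp: regular_module_def U.carrier_eq U.add_eq U.zero_eq verma_ideal_iff act_diff)

sublocale V: presented "verma \<chi> \<Lambda>" pv
  unfolding verma_def pv_def[abs_def] by (rule presented_quot.presented_quotient[OF presented_quot_verma])

lemma verma_smult: "pu g \<odot>\<^bsub>verma \<chi> \<Lambda>\<^esub> pv f = pv (g * f)"
  unfolding verma_def pv_def
  by (rule presented_quot.smult_quotient[OF presented_quot_verma])
    (simp_all add: regular_module_def pu_mult right_diff_distrib verma_ideal_mult)

lemma pv_eq_iff: "pv f = pv g \<longleftrightarrow> (\<forall>n. act f e0 n = act g e0 n)"
  unfolding pv_def presented_quot.coset_iff[OF presented_quot_verma]
  by (simp add: verma_ideal_iff act_diff)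

lemma verma_vec_eq: "verma_vec \<chi> \<Lambda> = pv 1"
  by (simp add: verma_vec_def pv_def U_one[OF bihom])

lemma presented_space_restrict_scalars:
  assumes "presented M p" and "\<And>f g. pu g \<odot>\<^bsub>M\<^esub> p f = p (g * f)"
  shows "presented_space (restrict_scalars (U \<chi>) M) p"
proof -
  interpret presented M p by (rule assms(1))
  show ?thesis
    by unfold_locales
      (simp_all add: restrict_scalars_def carrier_eq add_eq zero_eq U_one[OF bihom] U.smult_eq assms(2))
qed

sublocale RV: presented_space "restrict_scalars (U \<chi>) (verma \<chi> \<Lambda>)" pv
  by (rule presented_space_restrict_scalars[OF V.presented_axioms verma_smult])

lemma pv_nf: obtains g where "pv f = pv (nf g)"
  using vcong_nf[of f] vcong_act by (metis pv_eq_iff)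

lemma verma_degree_F_power:
  "pv (F ^ n) \<in> verma_degree \<chi> \<Lambda> (- Poly_Mapping.single i1 (int n))"
proof -
  have "to_Ut \<chi> (F ^ n) \<in> Ut_minus \<chi>"
    unfolding Ut_minus_eq using nf_F_power by (metis rangeI)
  then have "pu (F ^ n) \<in> U_minus_degree \<chi> (- Poly_Mapping.single i1 (int n))"
    using F_power_degree[of 1 n] by (simp add: U_minus_degree_def U_minus_def)
  then show ?thesis unfolding verma_degree_def verma_vec_eq
    by (rule rev_image_eqI) (simp add: verma_smult)
qed

lemma verma_degree_obtain:
  assumes "X \<in> verma_degree \<chi> \<Lambda> a"
  obtains g where "X = pv g" "\<And>n. act g e0 n \<noteq> 0 \<Longrightarrow> Poly_Mapping.lookup a i1 = - int n"
proof -
  from assms obtain g where "X = pu g \<odot>\<^bsub>verma \<chi> \<Lambda>\<^esub> pv 1" "\<forall>w\<in>Poly_Mapping.keys g. word_degree w = a"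
    by (auto simp: verma_degree_def U_minus_degree_def Ut_degree_def verma_vec_eq)
  with that[of g] act_degree[of g a] show ?thesis by (simp add: verma_smult)
qed

section \<open>The simple quotient\<close>

text \<open>The indices \<open>n\<close> for which \<open>F\<^sup>n v\<close> can be raised back to the highest weight vector.\<close>

definition good :: "nat set" where "good = {n. \<forall>j<n. cc (Suc j) \<noteq> 0}"

definition bad_part :: "('i, 'k) pre set set set set" where
  "bad_part = pv ` {f. \<forall>n\<in>good. act f e0 n = 0}"

lemma mem_bad_part: "pv f \<in> bad_part \<longleftrightarrow> (\<forall>n\<in>good. act f e0 n = 0)"
  unfolding bad_part_def by (auto simp: pv_eq_iff)

lemma bad_part_carrier: "bad_part \<subseteq> carrier (verma \<chi> \<Lambda>)"
    "bad_part \<subseteq> carrier (restrict_scalars (U \<chi>) (verma \<chi> \<Lambda>))"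
  by (auto simp: bad_part_def)

text \<open>\<open>good\<close> is an initial segment. From a good \<open>n\<close>, E reads the
  coordinate \<open>Suc n\<close>, which is good unless the coefficient \<open>cc (Suc n)\<close> is
  0; F reads the predecessor of a good index, which is good.\<close>

lemma act_good:
  assumes "\<forall>n\<in>good. v n = 0" shows "\<forall>n\<in>good. act g v n = 0"
proof (induction g rule: free_alg_gen_induct)
  case (gen h f)
  show ?case
  proof (cases h)
    case (GE i)
    have "cc (Suc n) * act f v (Suc n) = 0" if "n \<in> good" for n
      using gen that by (cases "cc (Suc n) = 0") (auto simp: good_def less_Suc_eq)
    then show ?thesis by (simp add: GE act_gen_mult)
  next
    case (GF i)
    then show ?thesis using gen by (auto simp: act_gen_mult good_def split: nat.split)
  qed (use gen in \<open>auto simp: act_gen_mult\<close>)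
qed (use assms in \<open>auto simp: act_scal act_add\<close>)

text \<open>The constant is the product of \<open>cc 1\<close>, ..., \<open>cc n\<close>, which does
  not vanish for good \<open>n\<close>.\<close>

lemma act_E_power: "\<exists>C. (\<forall>v. act (E ^ n) v 0 = C * v n) \<and> (n \<in> good \<longrightarrow> C \<noteq> 0)"
proof (induction n)
  case 0
  show ?case by (intro exI[of _ 1]) simp
next
  case (Suc n)
  then obtain C where C: "\<And>v. act (E ^ n) v 0 = C * v n" "n \<in> good \<longrightarrow> C \<noteq> 0" by blast
  show ?case
  proof (intro exI[of _ "C * cc (Suc n)"] conjI allI)
    show "act (E ^ Suc n) v 0 = C * cc (Suc n) * v (Suc n)" for v
      unfolding power_Suc2 by (simp add: act_mult C act_gen)
    show "Suc n \<in> good \<longrightarrow> C * cc (Suc n) \<noteq> 0" using C(2) by (auto simp: good_def)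
  qed
qed

text \<open>Each E lowers the highest coordinate by one, so after \<open>n\<close> steps only
  coordinate 0 can survive.\<close>

lemma act_E_power_above: "(\<And>m. m > n \<Longrightarrow> v m = 0) \<Longrightarrow> k > 0 \<Longrightarrow> act (E ^ n) v k = 0"
proof (induction n arbitrary: v)
  case (Suc n)
  have "act (E ^ n) (act E v) k = 0"
    using Suc.prems by (intro Suc.IH) (auto simp: act_gen)
  then show ?case unfolding power_Suc2 by (simp add: act_mult)
qed simp

lemma proper_graded_bad_part: "proper_graded_submodule \<chi> \<Lambda> bad_part"
  unfolding proper_graded_submodule_def
proof (intro conjI)
  show "left_submodule (U \<chi>) (verma \<chi> \<Lambda>) bad_part"
    unfolding left_submodule_def
  proof (intro conjI ballI)
    show "bad_part \<subseteq> carrier (verma \<chi> \<Lambda>)" by (rule bad_part_carrier)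
    show "\<zero>\<^bsub>verma \<chi> \<Lambda>\<^esub> \<in> bad_part" by (simp add: V.zero_eq mem_bad_part)
    fix X assume "X \<in> bad_part"
    then obtain f where f: "X = pv f" "\<forall>n\<in>good. act f e0 n = 0" by (auto simp: bad_part_def)
    show "X \<oplus>\<^bsub>verma \<chi> \<Lambda>\<^esub> Y \<in> bad_part" if "Y \<in> bad_part" for Y
    proof -
      from that obtain g where "Y = pv g" "\<forall>n\<in>good. act g e0 n = 0" by (auto simp: bad_part_def)
      with f show ?thesis by (simp add: V.add_eq mem_bad_part act_add)
    qed
    show "Y \<odot>\<^bsub>verma \<chi> \<Lambda>\<^esub> X \<in> bad_part" if Y: "Y \<in> carrier (U \<chi>)" for Y
    proof -
      from Y obtain g where "Y = pu g" by (rule U.carrier_obtain)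
      with act_good[OF f(2)] show ?thesis by (simp add: f verma_smult mem_bad_part act_mult)
    qed
  qed
  \<comment> \<open>Index 0 is good vacuously, and \<open>e0\<close> has coordinate 1 there.\<close>
  have "pv 1 \<notin> bad_part" by (auto simp: mem_bad_part good_def e0_def intro!: bexI[of _ 0])
  then show "bad_part \<noteq> carrier (verma \<chi> \<Lambda>)" using V.mem_carrier[of 1] by metis
  let ?RV = "restrict_scalars (U \<chi>) (verma \<chi> \<Lambda>)"
  let ?S = "\<Union>a. bad_part \<inter> verma_degree \<chi> \<Lambda> a"
  have S: "?S \<subseteq> carrier ?RV" using bad_part_carrier(2) by blast
  show "bad_part = kspan ?RV ?S"
  proof
    show "kspan ?RV ?S \<subseteq> bad_part"
      by (rule RV.span_least) (use bad_part_carrier in \<open>auto simp: mem_bad_part RV.zero_eq act_add act_scal_mult\<close>)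
    show "bad_part \<subseteq> kspan ?RV ?S"
    proof
      fix X assume X: "X \<in> bad_part"
      then obtain f where "X = pv f" by (auto simp: bad_part_def)
      then obtain g where g: "X = pv (nf g)" using pv_nf by metis
      \<comment> \<open>A monomial occurring in \<open>nf g\<close> has a bad exponent, since good
        coordinates of \<open>X\<close> vanish; it is therefore a homogeneous element of
        \<open>bad_part\<close>.\<close>
      have summand: "pv (Poly_Mapping.single w (Poly_Mapping.lookup (nf g) w)) \<in> kspan ?RV ?S"
        if "w \<in> Poly_Mapping.keys (nf g)" for w
      proof -
        from that keys_nf obtain n where n: "w = Fw n" by blast
        then have "act (nf g) e0 n \<noteq> 0" using that by (simp add: act_nf in_keys_iff)
        with X have "n \<notin> good" by (auto simp: g mem_bad_part)
        then have "pv (F ^ n) \<in> ?S"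
          using verma_degree_F_power[of n] by (auto simp: mem_bad_part act_F_power)
        then show ?thesis
          unfolding n single_Fw by (intro RV.span_smult[OF S] RV.span_incl[OF S])
      qed
      have "pv (\<Sum>w\<in>A. Poly_Mapping.single w (Poly_Mapping.lookup (nf g) w)) \<in> kspan ?RV ?S"
        if "finite A" "A \<subseteq> Poly_Mapping.keys (nf g)" for A
        using that
      proof (induction A rule: finite_induct)
        case empty
        show ?case using RV.span_zero[OF S] by (simp add: RV.zero_eq)
      next
        case (insert w A)
        from insert.prems have wA: "w \<in> Poly_Mapping.keys (nf g)" "A \<subseteq> Poly_Mapping.keys (nf g)" by auto
        show ?case unfolding sum.insert[OF insert.hyps]
          by (rule RV.span_add[OF S summand[OF wA(1)] insert.IH[OF wA(2)]])
      qed
      from this[of "Poly_Mapping.keys (nf g)"] show "X \<in> kspan ?RV ?S"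
        unfolding g by (simp flip: poly_mapping_sum_singles)
    qed
  qed
qed

text \<open>Gradedness reduces the claim to homogeneous elements. Such an element outside
  \<open>bad_part\<close> is a nonzero multiple of F^n v with \<open>n\<close> good, and E^n returns
  a nonzero multiple of v, which generates everything.\<close>

lemma proper_graded_sub_bad_part:
  assumes "proper_graded_submodule \<chi> \<Lambda> N" shows "N \<subseteq> bad_part"
proof -
  let ?RV = "restrict_scalars (U \<chi>) (verma \<chi> \<Lambda>)"
  have sub: "left_submodule (U \<chi>) (verma \<chi> \<Lambda>) N" and proper: "N \<noteq> carrier (verma \<chi> \<Lambda>)"
    and span: "N = kspan ?RV (\<Union>a. N \<inter> verma_degree \<chi> \<Lambda> a)"
    using assms unfolding proper_graded_submodule_def by blast+
  have mult: "pv (h * f) \<in> N" if "pv f \<in> N" for f h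
    using sub that by (auto simp: left_submodule_def simp flip: verma_smult)
  have "X \<in> bad_part" if X: "X \<in> N" "X \<in> verma_degree \<chi> \<Lambda> a" for X a
  proof (rule ccontr)
    assume bad: "X \<notin> bad_part"
    from X(2) obtain f where f: "X = pv f"
      "\<And>n. act f e0 n \<noteq> 0 \<Longrightarrow> Poly_Mapping.lookup a i1 = - int n"
      using verma_degree_obtain[OF X(2)] by metis
    with bad obtain n where n: "n \<in> good" "act f e0 n \<noteq> 0" by (auto simp: mem_bad_part)
    have supp: "act f e0 m = 0" if "m \<noteq> n" for m
      using f(2)[of m] f(2)[OF n(2)] that by auto
    obtain C where C: "\<And>v. act (E ^ n) v 0 = C * v n" "C \<noteq> 0" using act_E_power n(1) by blast
    define d where "d = C * act f e0 n"
    have "act (scal (inverse d) * E ^ n * f) e0 k = act 1 e0 k" for k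
    proof (cases "k = 0")
      case True
      have "d \<noteq> 0" using C(2) n(2) by (simp add: d_def)
      then show ?thesis using True by (simp add: act_mult act_scal C(1) e0_def flip: d_def)
    next
      case False
      have "act (E ^ n) (act f e0) k = 0" by (rule act_E_power_above) (use False supp in auto)
      then show ?thesis using False by (simp add: act_mult act_scal e0_def)
    qed
    then have "pv (scal (inverse d) * E ^ n * f) = pv 1" unfolding pv_eq_iff by blast
    then have "pv 1 \<in> N" using mult[of f] X(1) f(1) by metis
    with mult[of 1] have "carrier (verma \<chi> \<Lambda>) \<subseteq> N" by (auto simp: V.carrier_eq)
    with sub proper show False by (auto simp: left_submodule_def)
  qed
  then have "kspan ?RV (\<Union>a. N \<inter> verma_degree \<chi> \<Lambda> a) \<subseteq> bad_part"
    by (intro RV.span_least bad_part_carrier(2)) (auto simp: mem_bad_part RV.zero_eq act_add act_scal_mult)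
  with span show ?thesis by simp
qed

lemma max_submodule_eq: "max_submodule \<chi> \<Lambda> = bad_part"
  unfolding max_submodule_def
  by (rule Greatest_equality) (auto simp: proper_graded_bad_part dest: proper_graded_sub_bad_part)

section \<open>The dimension of the simple quotient\<close>

definition ps :: "('i, 'k) pre \<Rightarrow> ('i, 'k) pre set set set set" where
  "ps f = bad_part +>\<^bsub>verma \<chi> \<Lambda>\<^esub> pv f"

lemma presented_quot_simple: "presented_quot (verma \<chi> \<Lambda>) pv bad_part"
  by unfold_locales (use bad_part_carrier(1) in \<open>auto simp: mem_bad_part act_diff\<close>)

sublocale RS: presented_space "restrict_scalars (U \<chi>) (simple_module \<chi> \<Lambda>)" ps
proof (rule presented_space_restrict_scalars)
  show "presented (simple_module \<chi> \<Lambda>) ps"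
    unfolding simple_module_def max_submodule_eq ps_def[abs_def]
    by (rule presented_quot.presented_quotient[OF presented_quot_simple])
  show "pu g \<odot>\<^bsub>simple_module \<chi> \<Lambda>\<^esub> ps f = ps (g * f)" for f g
    unfolding simple_module_def max_submodule_eq ps_def
  proof (rule presented_quot.smult_quotient[OF presented_quot_simple, where s = "(*) g"])
    fix f assume "pv f \<in> bad_part"
    then have "\<forall>n\<in>good. act f e0 n = 0" by (simp add: mem_bad_part)
    from act_good[OF this] show "pv (g * f) \<in> bad_part" by (simp add: mem_bad_part act_mult)
  qed (simp_all add: verma_smult right_diff_distrib)
qed

lemma ps_eq_iff: "ps f = ps g \<longleftrightarrow> (\<forall>n\<in>good. act f e0 n = act g e0 n)"
  unfolding ps_def presented_quot.coset_iff[OF presented_quot_simple] by (simp add: mem_bad_part act_diff)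

text \<open>Finitely many vectors have representatives supported below a common bound B, and F^B v
  lies in their span only if B is not good. Conversely, a bad \<open>n\<close> makes all larger
  indices bad, so the F^k v with \<open>k < n\<close> span.\<close>

lemma finite_dim_simple_iff:
  "finite_dim (restrict_scalars (U \<chi>) (simple_module \<chi> \<Lambda>)) \<longleftrightarrow> (\<exists>n. n \<notin> good)"
proof
  let ?M = "restrict_scalars (U \<chi>) (simple_module \<chi> \<Lambda>)"
  \<comment> \<open>Only good coordinates are determined by an element of the quotient, so the
    vanishing from \<open>B\<close> on is asked of some representative.\<close>
  let ?T = "\<lambda>B. ps ` {f. \<forall>m\<ge>B. act f e0 m = 0}"
  assume "finite_dim ?M"
  then obtain A where A: "finite A" "A \<subseteq> carrier ?M" "kspan ?M A = carrier ?M"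
    unfolding RS.finite_dim_iff by blast
  have "\<exists>B. A \<subseteq> ?T B" using A(1,2)
  proof (induction A rule: finite_induct)
    case (insert X A)
    then obtain B where B: "A \<subseteq> ?T B" by blast
    from insert.prems obtain f where "X = ps f" by (auto simp: RS.carrier_eq)
    moreover obtain g where g: "vcong f (nf g)" using vcong_nf by blast
    ultimately have X: "X = ps (nf g)" using vcong_act by (simp add: ps_eq_iff)
    have "finite {m. act (nf g) e0 m \<noteq> 0}"
    proof (rule finite_imageD)
      have "Fw ` {m. act (nf g) e0 m \<noteq> 0} \<subseteq> Poly_Mapping.keys (nf g)"
        by (auto simp: act_nf in_keys_iff)
      then show "finite (Fw ` {m. act (nf g) e0 m \<noteq> 0})" by (rule finite_subset) simp
    qed (simp add: inj_on_def)
    then obtain B' where "\<forall>m\<in>{m. act (nf g) e0 m \<noteq> 0}. m \<le> B'" using finite_nat_set_iff_bounded_le by blast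
    \<comment> \<open>\<open>B'\<close> itself may carry a nonzero coordinate, hence the
      successor.\<close>
    then have "X \<in> ?T (max B (Suc B'))" unfolding X by (intro imageI) (auto simp: Suc_le_eq not_le[symmetric])
    moreover have "?T B \<subseteq> ?T (max B (Suc B'))" by auto
    ultimately show ?case using B by (meson insert_subset order_trans)
  qed simp
  then obtain B where B: "A \<subseteq> ?T B" by blast
  have "kspan ?M A \<subseteq> ?T B"
  proof (rule RS.span_least[OF B])
    show "?T B \<subseteq> carrier ?M" by auto
    show "\<zero>\<^bsub>?M\<^esub> \<in> ?T B" by (auto simp: RS.zero_eq intro!: imageI)
    fix x y c assume "ps x \<in> ?T B"
    then obtain f where f: "ps x = ps f" "\<forall>m\<ge>B. act f e0 m = 0" by auto
    then have "ps (scal c * x) = ps (scal c * f)" by (simp add: ps_eq_iff act_scal_mult)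
    with f show "ps (scal c * x) \<in> ?T B" by (auto simp: act_scal_mult)
    assume "ps y \<in> ?T B"
    then obtain g where g: "ps y = ps g" "\<forall>m\<ge>B. act g e0 m = 0" by auto
    with f have "ps (x + y) = ps (f + g)" by (simp add: ps_eq_iff act_add)
    with f g show "ps (x + y) \<in> ?T B" by (auto simp: act_add)
  qed
  then have "ps (F ^ B) \<in> ?T B" using A(3) RS.mem_carrier[of "F ^ B"] by blast
  then obtain f where "ps (F ^ B) = ps f" "\<forall>m\<ge>B. act f e0 m = 0" by blast
  then have "B \<notin> good" by (auto simp: ps_eq_iff act_F_power)
  then show "\<exists>n. n \<notin> good" ..
next
  let ?M = "restrict_scalars (U \<chi>) (simple_module \<chi> \<Lambda>)"
  assume "\<exists>n. n \<notin> good"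
  then obtain n where n: "n \<notin> good" ..
  let ?A = "(\<lambda>k. ps (F ^ k)) ` {..<n}"
  have A: "?A \<subseteq> carrier ?M" by auto
  have mem: "ps (F ^ k) \<in> kspan ?M ?A" for k
  proof (cases "k < n")
    case True
    then show ?thesis by (intro RS.span_incl[OF A]) auto
  next
    case False
    from n obtain j where "j < n" "cc (Suc j) = 0" by (auto simp: good_def)
    with False have "k \<notin> good" by (auto simp: good_def intro!: exI[of _ j])
    then have "ps (F ^ k) = ps 0" by (auto simp: ps_eq_iff act_F_power)
    then show ?thesis using RS.span_zero[OF A] by (simp add: RS.zero_eq)
  qed
  have "ps (nf f) \<in> kspan ?M ?A" for f
    by (induction f rule: nf_induct) (auto intro: RS.span_smult[OF A] RS.span_add[OF A] mem)
  moreover have "\<exists>g. ps f = ps (nf g)" for f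
    using vcong_nf[of f] vcong_act by (metis ps_eq_iff)
  ultimately have "carrier ?M \<subseteq> kspan ?M ?A" by (auto simp: RS.carrier_eq) metis
  with RS.span_sub[OF A] A show "finite_dim ?M"
    unfolding RS.finite_dim_iff by (intro exI[of _ ?A]) auto
qed

text \<open>Multiplying by q^r makes both q-numbers equal to [r+1], so \<open>cc (Suc r)\<close> q^r
  = (l q^r - k) [r+1], where k and l are the values of K and L. Here q and [r+1] are nonzero and can
  be cancelled.\<close>

lemma cc_zero_iff: "cc (Suc r) = 0 \<longleftrightarrow> \<Lambda> (uK \<chi> (\<alpha> i1) \<otimes>\<^bsub>U \<chi>\<^esub> uL \<chi> (- \<alpha> i1)) = q ^ r"
proof -
  define k l where "k = lam K1" and "l = lam L1"
  have "l * lam (fL (- \<alpha> i1)) = 1"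
    using mu_add[of "\<alpha> i1" "- \<alpha> i1"] by (simp add: l_def mu_0)
  then have l: "l \<noteq> 0" "lam (fL (- \<alpha> i1)) = inverse l"
    by (auto simp: inverse_unique)
  have lhs: "\<Lambda> (uK \<chi> (\<alpha> i1) \<otimes>\<^bsub>U \<chi>\<^esub> uL \<chi> (- \<alpha> i1)) = k * inverse l"
    using lam_mult[OF zero_part_K[of "\<alpha> i1"] zero_part_L[of "- \<alpha> i1"]] l(2)
    by (simp add: pu_mult lam_def[of "_ * _"] k_def)
  have "cc (Suc r) * q ^ r = l * q ^ r * qnum (Suc r) - k * (qnum' (Suc r) * q ^ r)"
    by (simp add: cc_eq k_def l_def algebra_simps)
  also have "\<dots> = (l * q ^ r - k) * qnum (Suc r)"
    unfolding qnum'_eq by (simp add: algebra_simps)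
  finally have "cc (Suc r) = 0 \<longleftrightarrow> l * q ^ r = k"
    using q_nonzero qnum_nonzero[OF infinite_dim, of "Suc r"]
    by (metis eq_iff_diff_eq_0 mult_eq_0_iff power_not_zero zero_less_Suc)
  also have "\<dots> \<longleftrightarrow> k * inverse l = q ^ r"
    using l(1) by (auto simp: field_simps)
  finally show ?thesis by (simp add: lhs)
qed

end

theorem theorem7p1:
  fixes \<chi> :: "('i::finite, 'k::field_char_0) bichar"
    and \<Lambda> :: "('i, 'k) weight"
    and i1 :: 'i
  assumes "card (UNIV :: 'i set) = 1"
    and "bihom \<chi>"
    and "\<not> finite_dim (U_minus \<chi>)"
    and "\<Lambda> \<in> Ch \<chi>"
  shows "finite_dim (restrict_scalars (U \<chi>) (simple_module \<chi> \<Lambda>)) \<longleftrightarrow>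
    (\<exists>r::nat. \<Lambda> (uK \<chi> (\<alpha> i1) \<otimes>\<^bsub>U \<chi>\<^esub> uL \<chi> (- \<alpha> i1)) = \<chi> (\<alpha> i1) (\<alpha> i1) ^ r)"
proof -
  have "i = i1" for i
    using assms(1) by (metis UNIV_I card_1_singletonE singletonD)
  then interpret rank_one_verma \<chi> i1 \<Lambda>
    using assms by unfold_locales
  have "(\<exists>n. n \<notin> good) \<longleftrightarrow> (\<exists>r. cc (Suc r) = 0)"
    by (auto simp: good_def)
  then show ?thesis
    by (simp add: finite_dim_simple_iff cc_zero_iff q_def)
qed

end
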